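(* Let $G$ and $H$ be finite groups and $F:\mathrm{Fin}_G\to\mathrm{Fin}_H$ a functor. The following are equivalent: (1) $F$ preserves pullbacks, epimorphisms, and finite coproducts (disjoint unions); (2) $F$ is of the form $F=-\times_G X$ (up to natural isomorphism) for some $X\in{}^{G}\mathrm{Fin}_H$.
   Context: $\mathrm{Fin}_G$ is the category of finite right $G$-sets (not necessarily free) and $G$-equivariant maps. ${}^{G}\mathrm{Fin}_H$ is the category of finite sets with commuting left $G$-action and right $H$-action such that the left $G$-action is free (no condition on the right $H$-action). For a right $G$-set $S$ and a left $G$-set $X$, $S\times_G X=(S\times X)/\sim$, where $\sim$ is the equivalence relation defined by $(sg,x)\sim(s,gx)$ for $g\in G$; if $X$ has a commuting right $H$-action then $S\times_G X$ is a right $H$-set. *)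

theory Defs
  imports "HOL-Algebra.Group_Action" "HOL-Library.Infinite_Typeclass"
begin

section \<open>Categories and functors\<close>

text \<open>
  Categories are given by hom-sets, which need not be disjoint. Hence composition and the
  action of a functor on morphisms carry the objects involved as arguments:
  \<open>Cmp C A B D g f\<close> is the composite of \<open>f\<close> from \<open>A\<close> to \<open>B\<close> with \<open>g\<close> from \<open>B\<close> to \<open>D\<close>,
  and \<open>amap F A B f\<close> is the image of \<open>f\<close> from \<open>A\<close> to \<open>B\<close>.
\<close>

record ('o, 'm) category =
  Ob :: "'o set"
  Hom :: "'o \<Rightarrow> 'o \<Rightarrow> 'm set"
  Ide :: "'o \<Rightarrow> 'm"
  Cmp :: "'o \<Rightarrow> 'o \<Rightarrow> 'o \<Rightarrow> 'm \<Rightarrow> 'm \<Rightarrow> 'm"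

definition is_category :: "('o, 'm) category \<Rightarrow> bool" where
  "is_category C \<longleftrightarrow>
     (\<forall>A\<in>Ob C. Ide C A \<in> Hom C A A) \<and>
     (\<forall>A\<in>Ob C. \<forall>B\<in>Ob C. \<forall>D\<in>Ob C. \<forall>f\<in>Hom C A B. \<forall>g\<in>Hom C B D.
        Cmp C A B D g f \<in> Hom C A D) \<and>
     (\<forall>A\<in>Ob C. \<forall>B\<in>Ob C. \<forall>f\<in>Hom C A B.
        Cmp C A A B f (Ide C A) = f \<and> Cmp C A B B (Ide C B) f = f) \<and>
     (\<forall>A\<in>Ob C. \<forall>B\<in>Ob C. \<forall>D\<in>Ob C. \<forall>E\<in>Ob C.
        \<forall>f\<in>Hom C A B. \<forall>g\<in>Hom C B D. \<forall>h\<in>Hom C D E.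
          Cmp C A D E h (Cmp C A B D g f) = Cmp C A B E (Cmp C B D E h g) f)"

record ('o1, 'm1, 'o2, 'm2) cfunctor =
  omap :: "'o1 \<Rightarrow> 'o2"
  amap :: "'o1 \<Rightarrow> 'o1 \<Rightarrow> 'm1 \<Rightarrow> 'm2"

definition is_functor ::
    "('o1, 'm1) category \<Rightarrow> ('o2, 'm2) category \<Rightarrow> ('o1, 'm1, 'o2, 'm2) cfunctor \<Rightarrow> bool" where
  "is_functor C D F \<longleftrightarrow>
     (\<forall>A\<in>Ob C. omap F A \<in> Ob D) \<and>
     (\<forall>A\<in>Ob C. \<forall>B\<in>Ob C. \<forall>f\<in>Hom C A B. amap F A B f \<in> Hom D (omap F A) (omap F B)) \<and>
     (\<forall>A\<in>Ob C. amap F A A (Ide C A) = Ide D (omap F A)) \<and>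
     (\<forall>A\<in>Ob C. \<forall>B\<in>Ob C. \<forall>E\<in>Ob C. \<forall>f\<in>Hom C A B. \<forall>g\<in>Hom C B E.
        amap F A E (Cmp C A B E g f) =
        Cmp D (omap F A) (omap F B) (omap F E) (amap F B E g) (amap F A B f))"

definition is_epi :: "('o, 'm) category \<Rightarrow> 'o \<Rightarrow> 'o \<Rightarrow> 'm \<Rightarrow> bool" where
  "is_epi C A B f \<longleftrightarrow>
     A \<in> Ob C \<and> B \<in> Ob C \<and> f \<in> Hom C A B \<and>
     (\<forall>Z\<in>Ob C. \<forall>u\<in>Hom C B Z. \<forall>v\<in>Hom C B Z.
        Cmp C A B Z u f = Cmp C A B Z v f \<longrightarrow> u = v)"

text \<open>
  \<open>is_pullback C A B D P f g p q\<close>: the cospan \<open>f\<close> from \<open>A\<close> to \<open>D\<close>, \<open>g\<close> from \<open>B\<close> to \<open>D\<close>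
  has pullback \<open>P\<close> with projections \<open>p\<close> to \<open>A\<close> and \<open>q\<close> to \<open>B\<close>.
\<close>

definition is_pullback ::
    "('o, 'm) category \<Rightarrow> 'o \<Rightarrow> 'o \<Rightarrow> 'o \<Rightarrow> 'o \<Rightarrow> 'm \<Rightarrow> 'm \<Rightarrow> 'm \<Rightarrow> 'm \<Rightarrow> bool" where
  "is_pullback C A B D P f g p q \<longleftrightarrow>
     A \<in> Ob C \<and> B \<in> Ob C \<and> D \<in> Ob C \<and> P \<in> Ob C \<and>
     f \<in> Hom C A D \<and> g \<in> Hom C B D \<and> p \<in> Hom C P A \<and> q \<in> Hom C P B \<and>
     Cmp C P A D f p = Cmp C P B D g q \<and>
     (\<forall>Z\<in>Ob C. \<forall>a\<in>Hom C Z A. \<forall>b\<in>Hom C Z B.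
        Cmp C Z A D f a = Cmp C Z B D g b \<longrightarrow>
        (\<exists>!u. u \<in> Hom C Z P \<and> Cmp C Z P A p u = a \<and> Cmp C Z P B q u = b))"

definition is_coproduct ::
    "('o, 'm) category \<Rightarrow> 'i set \<Rightarrow> ('i \<Rightarrow> 'o) \<Rightarrow> 'o \<Rightarrow> ('i \<Rightarrow> 'm) \<Rightarrow> bool" where
  "is_coproduct C I A K j \<longleftrightarrow>
     (\<forall>i\<in>I. A i \<in> Ob C) \<and> K \<in> Ob C \<and> (\<forall>i\<in>I. j i \<in> Hom C (A i) K) \<and>
     (\<forall>Z\<in>Ob C. \<forall>f. (\<forall>i\<in>I. f i \<in> Hom C (A i) Z) \<longrightarrow>
        (\<exists>!u. u \<in> Hom C K Z \<and> (\<forall>i\<in>I. Cmp C (A i) K Z u (j i) = f i)))"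

definition preserves_epis ::
    "('o1, 'm1) category \<Rightarrow> ('o2, 'm2) category \<Rightarrow> ('o1, 'm1, 'o2, 'm2) cfunctor \<Rightarrow> bool" where
  "preserves_epis C D F \<longleftrightarrow>
     (\<forall>A B f. is_epi C A B f \<longrightarrow> is_epi D (omap F A) (omap F B) (amap F A B f))"

definition preserves_pullbacks ::
    "('o1, 'm1) category \<Rightarrow> ('o2, 'm2) category \<Rightarrow> ('o1, 'm1, 'o2, 'm2) cfunctor \<Rightarrow> bool" where
  "preserves_pullbacks C D F \<longleftrightarrow>
     (\<forall>A B E P f g p q. is_pullback C A B E P f g p q \<longrightarrow>
        is_pullback D (omap F A) (omap F B) (omap F E) (omap F P)
          (amap F A E f) (amap F B E g) (amap F P A p) (amap F P B q))"

text \<open>The empty index set is included: the initial object is preserved.\<close>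

definition preserves_finite_coproducts ::
    "('o1, 'm1) category \<Rightarrow> ('o2, 'm2) category \<Rightarrow> ('o1, 'm1, 'o2, 'm2) cfunctor \<Rightarrow> bool" where
  "preserves_finite_coproducts C D F \<longleftrightarrow>
     (\<forall>(I :: nat set) A K j. finite I \<longrightarrow> is_coproduct C I A K j \<longrightarrow>
        is_coproduct D I (\<lambda>i. omap F (A i)) (omap F K) (\<lambda>i. amap F (A i) K (j i)))"


section \<open>Finite right \<open>G\<close>-sets\<close>

record ('u, 'g) gset =
  points :: "'u set"
  ract :: "'u \<Rightarrow> 'g \<Rightarrow> 'u"

text \<open>The last clause fixes the values of the action outside its domain, so that equality of
  records is equality of \<open>G\<close>-sets.\<close>

definition right_gset :: "('g, 'a) monoid_scheme \<Rightarrow> ('u, 'g, 'z) gset_scheme \<Rightarrow> bool" where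
  "right_gset G S \<longleftrightarrow>
     (\<forall>s\<in>points S. \<forall>g\<in>carrier G. ract S s g \<in> points S) \<and>
     (\<forall>s\<in>points S. ract S s \<one>\<^bsub>G\<^esub> = s) \<and>
     (\<forall>s\<in>points S. \<forall>g\<in>carrier G. \<forall>h\<in>carrier G.
        ract S s (g \<otimes>\<^bsub>G\<^esub> h) = ract S (ract S s g) h) \<and>
     (\<forall>s g. s \<notin> points S \<or> g \<notin> carrier G \<longrightarrow> ract S s g = undefined)"

text \<open>Equivariant maps; the two \<open>G\<close>-sets may have points of different types.\<close>

definition equivariant_maps ::
    "('g, 'a) monoid_scheme \<Rightarrow> ('u, 'g) gset \<Rightarrow> ('v, 'g) gset \<Rightarrow> ('u \<Rightarrow> 'v) set" where
  "equivariant_maps G S T =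
     {f \<in> points S \<rightarrow>\<^sub>E points T. \<forall>s\<in>points S. \<forall>g\<in>carrier G. f (ract S s g) = ract T (f s) g}"

text \<open>
  The category of finite right \<open>G\<close>-sets whose points are taken from the type \<open>'u\<close>. When \<open>'u\<close>
  is infinite, every finite \<open>G\<close>-set is isomorphic to one of these, so this is a model of the
  category of all finite right \<open>G\<close>-sets. For finite \<open>'u\<close> it would be too small.
\<close>

definition Fin :: "('g, 'a) monoid_scheme \<Rightarrow> (('u, 'g) gset, 'u \<Rightarrow> 'u) category" where
  "Fin G = \<lparr> Ob = {S. right_gset G S \<and> finite (points S)},
             Hom = equivariant_maps G,
             Ide = (\<lambda>S. \<lambda>s\<in>points S. s),
             Cmp = (\<lambda>S T U g f. compose (points S) g f) \<rparr>"

text \<open>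
  Natural isomorphism of functors into finite right \<open>H\<close>-sets. The values of \<open>F\<close> and \<open>F'\<close> may
  have points of different types, so an isomorphism is a bijective equivariant map and naturality
  is stated pointwise.
\<close>

definition naturally_isomorphic ::
    "('o, 'm) category \<Rightarrow> ('h, 'b) monoid_scheme \<Rightarrow>
     ('o, 'm, ('v, 'h) gset, 'v \<Rightarrow> 'v) cfunctor \<Rightarrow>
     ('o, 'm, ('w, 'h) gset, 'w \<Rightarrow> 'w) cfunctor \<Rightarrow> bool" where
  "naturally_isomorphic C H F F' \<longleftrightarrow>
     (\<exists>\<eta>. (\<forall>S\<in>Ob C. \<eta> S \<in> equivariant_maps H (omap F S) (omap F' S) \<and>
                    bij_betw (\<eta> S) (points (omap F S)) (points (omap F' S))) \<and>
          (\<forall>S\<in>Ob C. \<forall>T\<in>Ob C. \<forall>f\<in>Hom C S T. \<forall>y\<in>points (omap F S).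
             \<eta> T (amap F S T f y) = amap F' S T f (\<eta> S y)))"


section \<open>Left-free bisets and the functor \<open>- \<times>\<^sub>G X\<close>\<close>

record ('u, 'h, 'g) biset = "('u, 'h) gset" +
  lact :: "'g \<Rightarrow> 'u \<Rightarrow> 'u"

definition FinBiset ::
    "('g, 'a) monoid_scheme \<Rightarrow> ('h, 'b) monoid_scheme \<Rightarrow> ('u, 'h, 'g) biset set" where
  "FinBiset G H =
     {X. finite (points X) \<and> right_gset H X \<and> group_action G (points X) (lact X) \<and>
         (\<forall>x\<in>points X. \<forall>g\<in>carrier G. \<forall>h\<in>carrier H.
            lact X g (ract X x h) = ract X (lact X g x) h) \<and>
         (\<forall>x\<in>points X. \<forall>g\<in>carrier G. lact X g x = x \<longrightarrow> g = \<one>\<^bsub>G\<^esub>)}"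

text \<open>
  The pairs \<open>((s g, x), (s, g x))\<close>. No closure is needed: for a group \<open>G\<close> they already form
  an equivalence relation, see \<open>equiv_balanced_rel\<close>.
\<close>

definition balanced_rel ::
    "('g, 'a) monoid_scheme \<Rightarrow> ('u, 'g) gset \<Rightarrow> ('x, 'h, 'g) biset \<Rightarrow> (('u \<times> 'x) \<times> ('u \<times> 'x)) set" where
  "balanced_rel G S X =
     {((ract S s g, x), (s, lact X g x)) | s g x. s \<in> points S \<and> g \<in> carrier G \<and> x \<in> points X}"

definition tensor_gset ::
    "('g, 'a) monoid_scheme \<Rightarrow> ('h, 'b) monoid_scheme \<Rightarrow> ('x, 'h, 'g) biset \<Rightarrow>
     ('u, 'g) gset \<Rightarrow> (('u \<times> 'x) set, 'h) gset" where
  "tensor_gset G H X S =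
     (let Q = (points S \<times> points X) // balanced_rel G S X in
      \<lparr> points = Q,
        ract = (\<lambda>c h. if c \<in> Q \<and> h \<in> carrier H
                      then (\<Union>(s, x)\<in>c. balanced_rel G S X `` {(s, ract X x h)})
                      else undefined) \<rparr>)"

definition tensor_functor ::
    "('g, 'a) monoid_scheme \<Rightarrow> ('h, 'b) monoid_scheme \<Rightarrow> ('x, 'h, 'g) biset \<Rightarrow>
     (('u, 'g) gset, 'u \<Rightarrow> 'u, (('u \<times> 'x) set, 'h) gset, ('u \<times> 'x) set \<Rightarrow> ('u \<times> 'x) set) cfunctor" where
  "tensor_functor G H X =
     \<lparr> omap = tensor_gset G H X,
       amap = (\<lambda>S T f. \<lambda>c\<in>points (tensor_gset G H X S).
                 \<Union>(s, x)\<in>c. balanced_rel G T X `` {(f s, x)}) \<rparr>"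


section \<open>Well-definedness\<close>

lemma is_category_Fin:
  fixes G :: "('g, 'a) monoid_scheme"
  shows "is_category (Fin G :: (('u, 'g) gset, 'u \<Rightarrow> 'u) category)"
proof -
  have D: "f s \<in> points T" if "f \<in> equivariant_maps G S T" "s \<in> points S"
    for S T :: "('u, 'g) gset" and f s
    using that by (auto simp: equivariant_maps_def)
  have E: "f (ract S s g) = ract T (f s) g"
    if "f \<in> equivariant_maps G S T" "s \<in> points S" "g \<in> carrier G"
    for S T :: "('u, 'g) gset" and f s g
    using that by (auto simp: equivariant_maps_def)
  have X: "f s = undefined" if "f \<in> equivariant_maps G S T" "s \<notin> points S"
    for S T :: "('u, 'g) gset" and f s
    using that by (auto simp: equivariant_maps_def)
  have R: "ract S s g \<in> points S" if "right_gset G S" "s \<in> points S" "g \<in> carrier G"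
    for S :: "('u, 'g) gset" and s g
    using that by (auto simp: right_gset_def)
  have I: "(\<lambda>s\<in>points S. s) \<in> equivariant_maps G S S" if "right_gset G S" for S :: "('u, 'g) gset"
    using that by (auto simp: equivariant_maps_def R)
  have C: "compose (points S) g f \<in> equivariant_maps G S U"
    if "right_gset G S" "f \<in> equivariant_maps G S T" "g \<in> equivariant_maps G T U"
    for S T U :: "('u, 'g) gset" and f g
    using D[OF that(2)] D[OF that(3)] E[OF that(2)] E[OF that(3)] R[OF that(1)]
    by (auto simp: equivariant_maps_def compose_def)
  have IL: "compose (points S) f (\<lambda>s\<in>points S. s) = f" "compose (points S) (\<lambda>s\<in>points T. s) f = f"
    if "f \<in> equivariant_maps G S T" for S T :: "('u, 'g) gset" and f
    using D[OF that] X[OF that] by (auto simp: compose_def fun_eq_iff)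
  have A: "compose (points S) h (compose (points S) g f) = compose (points S) (compose (points T) h g) f"
    if "f \<in> equivariant_maps G S T" for S T :: "('u, 'g) gset" and f g h
    using D[OF that] by (auto simp: compose_def fun_eq_iff)
  show ?thesis
    unfolding is_category_def Fin_def by (simp add: I C IL) (blast intro: A)
qed

lemma equiv_balanced_rel:
  assumes G: "group G" and S: "right_gset G S" and X: "group_action G (points X) (lact X)"
  shows "equiv (points S \<times> points X) (balanced_rel G S X)"
proof -
  interpret G: group G by fact
  interpret X: group_action G "points X" "lact X" by fact
  have L: "lact X g x \<in> points X" if "g \<in> carrier G" "x \<in> points X" for g x
    using that X.element_image by blast
  have LL: "lact X (g \<otimes>\<^bsub>G\<^esub> h) x = lact X g (lact X h x)"
    if "g \<in> carrier G" "h \<in> carrier G" "x \<in> points X" for g h x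
    using that X.composition_rule by blast
  have L1: "lact X \<one>\<^bsub>G\<^esub> x = x" if "x \<in> points X" for x
    using that X.id_eq_one by (metis restrict_apply')
  have R: "ract S s g \<in> points S" if "g \<in> carrier G" "s \<in> points S" for g s
    using that S by (auto simp: right_gset_def)
  have RR: "ract S (ract S s g) h = ract S s (g \<otimes>\<^bsub>G\<^esub> h)"
    if "g \<in> carrier G" "h \<in> carrier G" "s \<in> points S" for g h s
    using that S by (auto simp: right_gset_def)
  have R1: "ract S s \<one>\<^bsub>G\<^esub> = s" if "s \<in> points S" for s
    using that S by (auto simp: right_gset_def)
  have I: "((s, x), (t, y)) \<in> balanced_rel G S X \<longleftrightarrow>
      t \<in> points S \<and> x \<in> points X \<and> (\<exists>g\<in>carrier G. s = ract S t g \<and> y = lact X g x)" for s x t y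
    unfolding balanced_rel_def by blast
  show ?thesis
  proof (rule equivI)
    show "balanced_rel G S X \<subseteq> (points S \<times> points X) \<times> (points S \<times> points X)"
      using L R by (auto simp: balanced_rel_def)
    show "refl_on (points S \<times> points X) (balanced_rel G S X)"
    proof (rule refl_onI, clarify)
      fix s x assume "s \<in> points S" "x \<in> points X"
      then have "s \<in> points S \<and> x \<in> points X \<and> s = ract S s \<one>\<^bsub>G\<^esub> \<and> x = lact X \<one>\<^bsub>G\<^esub> x"
        by (simp add: L1 R1)
      then show "((s, x), (s, x)) \<in> balanced_rel G S X"
        unfolding I using G.one_closed by blast
    qed
    show "sym (balanced_rel G S X)"
    proof (rule symI, clarify)
      fix s x t y assume "((s, x), (t, y)) \<in> balanced_rel G S X"
      then obtain g where g: "t \<in> points S" "x \<in> points X" "g \<in> carrier G"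
        "s = ract S t g" "y = lact X g x" unfolding I by blast
      have "t = ract S s (inv\<^bsub>G\<^esub> g)" "x = lact X (inv\<^bsub>G\<^esub> g) y"
        using g by (simp_all add: RR R1 LL[symmetric] L1)
      moreover have "s \<in> points S" "y \<in> points X" using g L R by simp_all
      ultimately show "((t, y), (s, x)) \<in> balanced_rel G S X"
        unfolding I using G.inv_closed[OF g(3)] by blast
    qed
    show "trans (balanced_rel G S X)"
    proof (rule transI, clarify)
      fix s x t y u z
      assume "((s, x), (t, y)) \<in> balanced_rel G S X" "((t, y), (u, z)) \<in> balanced_rel G S X"
      then obtain g h where g: "t \<in> points S" "x \<in> points X" "g \<in> carrier G"
        "s = ract S t g" "y = lact X g x" "u \<in> points S" "h \<in> carrier G"
        "t = ract S u h" "z = lact X h y" unfolding I by blast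
      from g have "s = ract S u (h \<otimes>\<^bsub>G\<^esub> g)" "z = lact X (h \<otimes>\<^bsub>G\<^esub> g) x"
        by (simp_all add: RR LL)
      then show "((s, x), (u, z)) \<in> balanced_rel G S X"
        unfolding I using g G.m_closed[OF g(7) g(3)] by blast
    qed
  qed
qed

lemma UN_balanced_rel:
  assumes "equiv A r" "equiv B r'" "p \<in> A" and "\<And>p q. (p, q) \<in> r \<Longrightarrow> (k p, k q) \<in> r'"
  shows "(\<Union>q\<in>r `` {p}. r' `` {k q}) = r' `` {k p}"
proof (rule UN_equiv_class[OF assms(1) _ assms(3)])
  show "(\<lambda>q. r' `` {k q}) respects r"
    using assms(2,4) by (auto simp: congruent_def intro!: equiv_class_eq)
qed

lemma points_tensor_gset:
  "points (tensor_gset G H X S) = (points S \<times> points X) // balanced_rel G S X"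
  by (simp add: tensor_gset_def Let_def)

lemma ract_tensor_gset:
  assumes G: "group G" and S: "right_gset G S" and X: "X \<in> FinBiset G H"
    and s: "s \<in> points S" and x: "x \<in> points X" and h: "h \<in> carrier H"
  shows "ract (tensor_gset G H X S) (balanced_rel G S X `` {(s, x)}) h =
         balanced_rel G S X `` {(s, ract X x h)}"
proof -
  have eq: "equiv (points S \<times> points X) (balanced_rel G S X)"
    by (rule equiv_balanced_rel[OF G S]) (use X in \<open>simp add: FinBiset_def\<close>)
  have "(\<Union>p\<in>balanced_rel G S X `` {(s, x)}. balanced_rel G S X `` {(\<lambda>(s, x). (s, ract X x h)) p}) =
      balanced_rel G S X `` {(\<lambda>(s, x). (s, ract X x h)) (s, x)}"
  proof (rule UN_balanced_rel[OF eq eq])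
    fix p q assume "(p, q) \<in> balanced_rel G S X"
    then obtain t g y where p: "p = (ract S t g, y)" "q = (t, lact X g y)"
      "t \<in> points S" "g \<in> carrier G" "y \<in> points X" by (auto simp: balanced_rel_def)
    then have "ract X y h \<in> points X" "ract X (lact X g y) h = lact X g (ract X y h)"
      using X h by (auto simp: FinBiset_def right_gset_def)
    then show "((\<lambda>(s, x). (s, ract X x h)) p, (\<lambda>(s, x). (s, ract X x h)) q) \<in> balanced_rel G S X"
      using p by (auto simp: balanced_rel_def)
  qed (use s x in auto)
  then show ?thesis
    using s x h by (simp add: tensor_gset_def Let_def quotientI case_prod_unfold)
qed

lemma amap_tensor_functor:
  assumes G: "group G" and S: "right_gset G S" and T: "right_gset G T" and X: "X \<in> FinBiset G H"
    and f: "f \<in> equivariant_maps G S T" and s: "s \<in> points S" and x: "x \<in> points X"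
  shows "amap (tensor_functor G H X) S T f (balanced_rel G S X `` {(s, x)}) =
         balanced_rel G T X `` {(f s, x)}"
proof -
  have eq: "equiv (points S \<times> points X) (balanced_rel G S X)"
    "equiv (points T \<times> points X) (balanced_rel G T X)"
    by (rule equiv_balanced_rel[OF G S] equiv_balanced_rel[OF G T],
        use X in \<open>simp add: FinBiset_def\<close>)+
  have "(\<Union>p\<in>balanced_rel G S X `` {(s, x)}. balanced_rel G T X `` {(\<lambda>(s, x). (f s, x)) p}) =
      balanced_rel G T X `` {(\<lambda>(s, x). (f s, x)) (s, x)}"
  proof (rule UN_balanced_rel[OF eq])
    fix p q assume "(p, q) \<in> balanced_rel G S X"
    then obtain t g y where p: "p = (ract S t g, y)" "q = (t, lact X g y)"
      "t \<in> points S" "g \<in> carrier G" "y \<in> points X" by (auto simp: balanced_rel_def)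
    moreover have "f t \<in> points T" "f (ract S t g) = ract T (f t) g"
      using f p by (auto simp: equivariant_maps_def)
    ultimately show "((\<lambda>(s, x). (f s, x)) p, (\<lambda>(s, x). (f s, x)) q) \<in> balanced_rel G T X"
      by (auto simp: balanced_rel_def)
  qed (use s x in auto)
  then show ?thesis
    using s x by (simp add: tensor_functor_def points_tensor_gset quotientI case_prod_unfold)
qed

lemma is_functor_tensor_functor:
  fixes G :: "('g, 'a) monoid_scheme" and H :: "('h, 'b) monoid_scheme"
    and X :: "('x, 'h, 'g) biset"
  assumes G: "group G" and H: "group H" and X: "X \<in> FinBiset G H"
  shows "is_functor (Fin G :: (('u, 'g) gset, 'u \<Rightarrow> 'u) category) (Fin H) (tensor_functor G H X)"
proof -
  let ?c = "\<lambda>(S :: ('u, 'g) gset) s x. balanced_rel G S X `` {(s, x)}"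
  interpret H: group H by fact
  have XH: "right_gset H X" "finite (points X)" using X by (simp_all add: FinBiset_def)
  have XR: "ract X x h \<in> points X" if "x \<in> points X" "h \<in> carrier H" for x h
    using that XH by (simp add: right_gset_def)
  have X1: "ract X x \<one>\<^bsub>H\<^esub> = x" if "x \<in> points X" for x
    using that XH by (simp add: right_gset_def)
  have XM: "ract X x (h \<otimes>\<^bsub>H\<^esub> k) = ract X (ract X x h) k"
    if "x \<in> points X" "h \<in> carrier H" "k \<in> carrier H" for x h k
    using that XH by (simp add: right_gset_def)
  have om: "omap (tensor_functor G H X :: (('u, 'g) gset, _, _, _) cfunctor) = tensor_gset G H X" by (simp add: tensor_functor_def)
  have elE: "\<exists>s x. s \<in> points S \<and> x \<in> points X \<and> c = ?c S s x"
    if "c \<in> points (tensor_gset G H X S)" for S :: "('u, 'g) gset" and c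
    using that unfolding points_tensor_gset quotient_def by blast
  have elI: "?c S s x \<in> points (tensor_gset G H X S)" if "s \<in> points S" "x \<in> points X"
    for S :: "('u, 'g) gset" and s x
    using that unfolding points_tensor_gset by (simp add: quotientI)
  have ra: "ract (tensor_gset G H X S) (?c S s x) h = ?c S s (ract X x h)"
    if "right_gset G S" "s \<in> points S" "x \<in> points X" "h \<in> carrier H"
    for S :: "('u, 'g) gset" and s x h
    using that by (rule ract_tensor_gset[OF G _ X])
  have am: "amap (tensor_functor G H X) S T f (?c S s x) = ?c T (f s) x"
    if "right_gset G S" "right_gset G T" "f \<in> equivariant_maps G S T" "s \<in> points S" "x \<in> points X"
    for S T :: "('u, 'g) gset" and f s x
    using that by (intro amap_tensor_functor[OF G _ _ X])
  have ext: "amap (tensor_functor G H X) S T f \<in> extensional (points (tensor_gset G H X S))" for S T :: "('u, 'g) gset" and f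
    by (simp add: tensor_functor_def)
  have ob: "right_gset H (tensor_gset G H X S)" if S: "right_gset G S" for S :: "('u, 'g) gset"
    unfolding right_gset_def
  proof (intro conjI ballI allI impI)
    fix c assume "c \<in> points (tensor_gset G H X S)"
    from elE[OF this] obtain s x where c: "s \<in> points S" "x \<in> points X" "c = ?c S s x" by blast
    show "ract (tensor_gset G H X S) c \<one>\<^bsub>H\<^esub> = c"
      using c ra[OF S] by (simp add: XR X1 XM)
    fix h assume h: "h \<in> carrier H"
    show "ract (tensor_gset G H X S) c h \<in> points (tensor_gset G H X S)"
      using c h ra[OF S] elI by (simp add: XR)
    fix k assume k: "k \<in> carrier H"
    show "ract (tensor_gset G H X S) c (h \<otimes>\<^bsub>H\<^esub> k) =
        ract (tensor_gset G H X S) (ract (tensor_gset G H X S) c h) k"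
      using c h k ra[OF S] by (simp add: XR X1 XM)
  next
    fix c h assume "c \<notin> points (tensor_gset G H X S) \<or> h \<notin> carrier H"
    then show "ract (tensor_gset G H X S) c h = undefined"
      by (auto simp: tensor_gset_def Let_def)
  qed
  have fin: "finite (points (tensor_gset G H X S))" if "right_gset G S" "finite (points S)" for S :: "('u, 'g) gset"
  proof -
    have "points (tensor_gset G H X S) = (\<lambda>(s, x). ?c S s x) ` (points S \<times> points X)"
      by (auto simp: elI dest!: elE)
    then show ?thesis using that XH by simp
  qed
  have mor: "amap (tensor_functor G H X) S T f \<in>
      equivariant_maps H (tensor_gset G H X S) (tensor_gset G H X T)"
    if S: "right_gset G S" and T: "right_gset G T" and f: "f \<in> equivariant_maps G S T" for S T :: "('u, 'g) gset" and f
    unfolding equivariant_maps_def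
  proof (intro CollectI conjI ballI PiE_I)
    have ft: "f s \<in> points T" if "s \<in> points S" for s
      using f that by (auto simp: equivariant_maps_def)
    fix c assume "c \<in> points (tensor_gset G H X S)"
    from elE[OF this] obtain s x where c: "s \<in> points S" "x \<in> points X" "c = ?c S s x" by blast
    show "amap (tensor_functor G H X) S T f c \<in> points (tensor_gset G H X T)"
      using c am[OF S T f] ft elI by simp
    fix h assume h: "h \<in> carrier H"
    show "amap (tensor_functor G H X) S T f (ract (tensor_gset G H X S) c h) =
        ract (tensor_gset G H X T) (amap (tensor_functor G H X) S T f c) h"
      using c h am[OF S T f] ra[OF S] ra[OF T] ft by (simp add: XR X1 XM)
  next
    fix c assume "c \<notin> points (tensor_gset G H X S)"
    then show "amap (tensor_functor G H X) S T f c = undefined"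
      using ext by (rule extensional_arb[rotated])
  qed
  have ide: "amap (tensor_functor G H X) S S (\<lambda>s\<in>points S. s) =
      (\<lambda>c\<in>points (tensor_gset G H X S). c)" if S: "right_gset G S" for S :: "('u, 'g) gset"
  proof (rule extensionalityI[OF ext])
    have i: "(\<lambda>s\<in>points S. s) \<in> equivariant_maps G S S"
      using S by (auto simp: equivariant_maps_def right_gset_def)
    fix c assume c': "c \<in> points (tensor_gset G H X S)"
    from elE[OF this] obtain s x where c: "s \<in> points S" "x \<in> points X" "c = ?c S s x" by blast
    show "amap (tensor_functor G H X) S S (\<lambda>s\<in>points S. s) c =
        (\<lambda>c\<in>points (tensor_gset G H X S). c) c"
      using c c' am[OF S S i] by simp
  qed simp
  have cmp: "amap (tensor_functor G H X) S U (compose (points S) g f) =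
      compose (points (tensor_gset G H X S)) (amap (tensor_functor G H X) T U g)
        (amap (tensor_functor G H X) S T f)"
    if S: "right_gset G S" and T: "right_gset G T" and U: "right_gset G U"
      and f: "f \<in> equivariant_maps G S T" and g: "g \<in> equivariant_maps G T U" for S T U :: "('u, 'g) gset" and f g
  proof (rule extensionalityI[OF ext])
    have i: "compose (points S) g f \<in> equivariant_maps G S U"
      using S f g by (auto simp: equivariant_maps_def right_gset_def compose_def)
    fix c assume c': "c \<in> points (tensor_gset G H X S)"
    from elE[OF this] obtain s x where c: "s \<in> points S" "x \<in> points X" "c = ?c S s x" by blast
    have "f s \<in> points T" using c f by (auto simp: equivariant_maps_def)
    then show "amap (tensor_functor G H X) S U (compose (points S) g f) c =
        compose (points (tensor_gset G H X S)) (amap (tensor_functor G H X) T U g)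
        (amap (tensor_functor G H X) S T f) c"
      using c c' am[OF S U i] am[OF S T f] am[OF T U g] by (simp add: compose_def)
  qed simp
  show ?thesis
    unfolding is_functor_def Fin_def om by (simp add: ob fin mor ide cmp)
qed

end

theory Submission
  imports Defs
begin

text \<open>
  Let \<open>R\<close> be \<open>G\<close> acting on itself from the right. A point \<open>s\<close> of a right \<open>G\<close>-set \<open>S\<close> is the same as a
  map from \<open>R\<close> to \<open>S\<close>, so every functor \<open>F\<close> comes with a natural pairing from \<open>S \<times> F R\<close> to \<open>F S\<close>
  (\<open>generated\<close>). The left translations of \<open>R\<close> make \<open>X = F R\<close> a biset, for which the pairing is balanced
  (\<open>generated_balanced\<close>). If \<open>F\<close> preserves pullbacks, epimorphisms and finite coproducts, then the
  induced map from \<open>S \<times>\<^sub>G X\<close> to \<open>F S\<close> is bijective and \<open>X\<close> is left-free. It is surjective because \<open>S\<close> is a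
  quotient of a coproduct of copies of \<open>R\<close>, one for each point (\<open>generated_surj\<close>). For injectivity,
  consider two maps from \<open>R\<close> to \<open>S\<close>, given by points \<open>s\<close> and \<open>t\<close>. Their pullback is a coproduct of copies
  of \<open>R\<close> indexed by the group elements \<open>c\<close> with \<open>s = t c\<close>. Applying \<open>F\<close>, the points \<open>x\<close> and \<open>y\<close> of \<open>X\<close>
  satisfy \<open>(s, x) = (t, y)\<close> in \<open>F S\<close> iff \<open>s = t c\<close> and \<open>y = c x\<close> for some \<open>c\<close>, and this \<open>c\<close> is unique
  (\<open>generated_pairs\<close>). Existence of \<open>c\<close> is injectivity. Uniqueness, for a one-point \<open>S\<close>, is freeness.

  Conversely, the points of \<open>S \<times>\<^sub>G X\<close> are represented by pairs, and preservation is checked on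
  representatives; for pullbacks, left-freeness of \<open>X\<close> makes the lift of a pair of points unique
  (\<open>pullbacks\<close>). Both directions speak of \<open>S \<times>\<^sub>G X\<close> through
  the map from pairs to classes (\<open>tensor_presentation\<close>).

  The elementwise arguments rest on descriptions of the universal properties in terms of points:
  epimorphisms are the surjections, pullbacks the fibre products, coproducts the disjoint unions
  (\<open>is_epi_Fin_iff\<close>, \<open>is_pullback_Fin_iff\<close>, \<open>is_coproduct_Fin_iff\<close>).
\<close>

section \<open>Finite right sets\<close>

lemma Ob_Fin: "S \<in> Ob (Fin G) \<longleftrightarrow> right_gset G S \<and> finite (points S)"
  and Hom_Fin: "Hom (Fin G) = equivariant_maps G"
  and Ide_Fin: "Ide (Fin G) S = (\<lambda>s\<in>points S. s)"
  and Cmp_Fin: "Cmp (Fin G) S T U g f = compose (points S) g f"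
  by (simp_all add: Fin_def)

lemma ract_closed: "S \<in> Ob (Fin G) \<Longrightarrow> s \<in> points S \<Longrightarrow> g \<in> carrier G \<Longrightarrow> ract S s g \<in> points S"
  and ract_one: "S \<in> Ob (Fin G) \<Longrightarrow> s \<in> points S \<Longrightarrow> ract S s \<one>\<^bsub>G\<^esub> = s"
  and ract_mult: "S \<in> Ob (Fin G) \<Longrightarrow> s \<in> points S \<Longrightarrow> g \<in> carrier G \<Longrightarrow> h \<in> carrier G \<Longrightarrow>
    ract S s (g \<otimes>\<^bsub>G\<^esub> h) = ract S (ract S s g) h"
  by (simp_all add: Ob_Fin right_gset_def)

lemma equivariant_mapsI:
  assumes "\<And>s. s \<in> points S \<Longrightarrow> f s \<in> points T" and "f \<in> extensional (points S)"
    and "\<And>s g. s \<in> points S \<Longrightarrow> g \<in> carrier G \<Longrightarrow> f (ract S s g) = ract T (f s) g"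
  shows "f \<in> equivariant_maps G S T"
  using assms by (auto simp: equivariant_maps_def PiE_def)

lemma equivariant_maps_closed: "f \<in> equivariant_maps G S T \<Longrightarrow> s \<in> points S \<Longrightarrow> f s \<in> points T"
  and equivariant_maps_ract: "f \<in> equivariant_maps G S T \<Longrightarrow> s \<in> points S \<Longrightarrow> g \<in> carrier G \<Longrightarrow>
    f (ract S s g) = ract T (f s) g"
  and equivariant_maps_extensional: "f \<in> equivariant_maps G S T \<Longrightarrow> f \<in> extensional (points S)"
  by (auto simp: equivariant_maps_def PiE_def)

lemma equivariant_maps_eqI:
  assumes "f \<in> equivariant_maps G S T" "f' \<in> equivariant_maps G S T'"
    and "\<And>s. s \<in> points S \<Longrightarrow> f s = f' s"
  shows "f = f'"
  using assms by (blast intro: extensionalityI equivariant_maps_extensional)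

lemma equivariant_maps_compose:
  assumes "S \<in> Ob (Fin G)" "f \<in> equivariant_maps G S T" "g \<in> equivariant_maps G T U"
  shows "compose (points S) g f \<in> equivariant_maps G S U"
  using assms
  by (intro equivariant_mapsI)
    (simp_all add: compose_eq ract_closed equivariant_maps_closed equivariant_maps_ract)

text \<open>An infinite type has room for a copy of every finite set, so finite right sets may be built
  on any convenient type and then moved into the type at hand.\<close>

lemma gset_transport:
  fixes T :: "('w, 'g) gset" and G :: "('g, 'a) monoid_scheme"
  assumes T: "right_gset G T" "finite (points T)" and G: "group G"
  obtains K :: "('u::infinite, 'g) gset" and e
  where "K \<in> Ob (Fin G)" "bij_betw e (points T) (points K)"
    "\<And>t g. t \<in> points T \<Longrightarrow> g \<in> carrier G \<Longrightarrow> e (ract T t g) = ract K (e t) g"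
proof -
  interpret group G by fact
  obtain B :: "'u set" where "finite B" "card B = card (points T)"
    using infinite_arbitrarily_large[OF infinite_UNIV] by metis
  then obtain e where e: "bij_betw e (points T) B"
    using T(2) finite_same_card_bij by metis
  define d where "d = the_inv_into (points T) e"
  have d: "d (e t) = t" if "t \<in> points T" for t
    using that e by (simp add: d_def the_inv_into_f_f bij_betw_def)
  have B: "B = e ` points T" using e by (simp add: bij_betw_def)
  define K where "K = \<lparr>points = B,
    ract = (\<lambda>b g. if b \<in> B \<and> g \<in> carrier G then e (ract T (d b) g) else undefined)\<rparr>"
  have "K \<in> Ob (Fin G)"
    using T unfolding Ob_Fin right_gset_def K_def by (auto simp: B d)
  moreover have "e (ract T t g) = ract K (e t) g" if "t \<in> points T" "g \<in> carrier G" for t g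
    using that by (simp add: K_def B d)
  ultimately show thesis using that e by (simp add: K_def)
qed


section \<open>The free orbit\<close>

text \<open>The set \<open>G\<close> with its action on itself from the right, up to isomorphism: \<open>r\<^sub>0\<close> stands for the
  unit of \<open>G\<close>, and \<open>orbit_map S s\<close> sends \<open>r\<^sub>0 g\<close> to \<open>s g\<close>.\<close>

locale free_orbit = group G for G :: "('g, 'a) monoid_scheme" (structure) +
  fixes R :: "('u, 'g) gset" and r\<^sub>0 :: 'u
  assumes R: "R \<in> Ob (Fin G)" and r0: "r\<^sub>0 \<in> points R"
    and free: "bij_betw (ract R r\<^sub>0) (carrier G) (points R)"
begin

definition orbit_map :: "('u, 'g) gset \<Rightarrow> 'u \<Rightarrow> 'u \<Rightarrow> 'u" where
  "orbit_map S s = (\<lambda>r\<in>points R. ract S s (the_inv_into (carrier G) (ract R r\<^sub>0) r))"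

lemma pointE:
  assumes "r \<in> points R"
  obtains g where "g \<in> carrier G" "r = ract R r\<^sub>0 g"
  using assms free by (auto simp: bij_betw_def)

lemma point_inj:
  "g \<in> carrier G \<Longrightarrow> h \<in> carrier G \<Longrightarrow> ract R r\<^sub>0 g = ract R r\<^sub>0 h \<longleftrightarrow> g = h"
  using free by (auto simp: bij_betw_def inj_on_def)

lemma orbit_map_point: "g \<in> carrier G \<Longrightarrow> orbit_map S s (ract R r\<^sub>0 g) = ract S s g"
  using free ract_closed[OF R r0]
  by (simp add: orbit_map_def the_inv_into_f_f bij_betw_def)

lemma orbit_map_base: "S \<in> Ob (Fin G) \<Longrightarrow> s \<in> points S \<Longrightarrow> orbit_map S s r\<^sub>0 = s"
  using orbit_map_point[of \<one> S s] ract_one[OF R r0] ract_one[of S G s] by simp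

lemma orbit_map_hom:
  assumes S: "S \<in> Ob (Fin G)" "s \<in> points S"
  shows "orbit_map S s \<in> equivariant_maps G R S"
proof (rule equivariant_mapsI)
  show "orbit_map S s \<in> extensional (points R)" by (simp add: orbit_map_def)
  fix r assume "r \<in> points R"
  then obtain g where g: "g \<in> carrier G" "r = ract R r\<^sub>0 g" by (rule pointE)
  then show "orbit_map S s r \<in> points S" using S by (simp add: orbit_map_point ract_closed)
  fix h assume "h \<in> carrier G"
  then show "orbit_map S s (ract R r h) = ract S (orbit_map S s r) h"
    using g S R r0 by (simp add: orbit_map_point ract_mult[symmetric])
qed

text \<open>The free orbit represents the underlying-set functor: a map out of it is determined by the
  image of the base point, as in the Yoneda lemma.\<close>

lemma orbit_map_unique:
  assumes f: "f \<in> equivariant_maps G R S"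
  shows "f = orbit_map S (f r\<^sub>0)"
proof (rule extensionalityI[OF equivariant_maps_extensional[OF f]])
  show "orbit_map S (f r\<^sub>0) \<in> extensional (points R)" by (simp add: orbit_map_def)
  fix r assume "r \<in> points R"
  then obtain g where g: "g \<in> carrier G" "r = ract R r\<^sub>0 g" by (rule pointE)
  then show "f r = orbit_map S (f r\<^sub>0) r"
    using equivariant_maps_ract[OF f r0] by (simp add: orbit_map_point)
qed

lemma compose_orbit_map:
  assumes "S \<in> Ob (Fin G)" "s \<in> points S" "f \<in> equivariant_maps G S T"
  shows "compose (points R) f (orbit_map S s) = orbit_map T (f s)"
  using orbit_map_unique[OF equivariant_maps_compose[OF R orbit_map_hom[OF assms(1,2)] assms(3)]]
    assms r0 by (simp add: compose_eq orbit_map_base)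

lemma orbit_map_id: "orbit_map R r\<^sub>0 = (\<lambda>r\<in>points R. r)"
proof -
  have "(\<lambda>r\<in>points R. r) \<in> equivariant_maps G R R"
    using R by (intro equivariant_mapsI) (auto simp: ract_closed)
  from orbit_map_unique[OF this] show ?thesis using r0 by simp
qed

end

lemma free_orbit_exists:
  fixes G :: "('g, 'a) monoid_scheme"
  assumes G: "group G" and fin: "finite (carrier G)"
  obtains R :: "('u::infinite, 'g) gset" and r where "free_orbit G R r"
proof -
  interpret group G by fact
  define T where "T = \<lparr>points = carrier G, ract = (\<lambda>s g. if s \<in> carrier G \<and> g \<in> carrier G
    then s \<otimes>\<^bsub>G\<^esub> g else undefined)\<rparr>"
  have "right_gset G T" "finite (points T)"
    using fin by (auto simp: T_def right_gset_def m_assoc)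
  then obtain R :: "('u, 'g) gset" and e where Re: "R \<in> Ob (Fin G)" "bij_betw e (points T) (points R)"
    and e: "\<And>t g. t \<in> points T \<Longrightarrow> g \<in> carrier G \<Longrightarrow> e (ract T t g) = ract R (e t) g"
    using G by (rule gset_transport) (rule that)
  have "ract R (e \<one>\<^bsub>G\<^esub>) g = e g" if "g \<in> carrier G" for g
    using e[of "\<one>\<^bsub>G\<^esub>" g] that by (simp add: T_def)
  then have "bij_betw (ract R (e \<one>\<^bsub>G\<^esub>)) (carrier G) (points R)"
    using Re(2) by (subst bij_betw_cong[where g = e]) (simp_all add: T_def)
  moreover have "e \<one>\<^bsub>G\<^esub> \<in> points R"
    using Re(2) by (auto simp: T_def bij_betw_def)
  ultimately have "free_orbit G R (e \<one>\<^bsub>G\<^esub>)"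
    using G Re(1) by (simp add: free_orbit_def free_orbit_axioms_def)
  then show thesis by (rule that)
qed


section \<open>Epimorphisms, pullbacks and coproducts of finite right sets\<close>

text \<open>If \<open>M\<close> is invariant, then its indicator and the constant map are equivariant maps to a two-point
  set with trivial action. They agree on \<open>M\<close>, so if maps are determined by their restriction to \<open>M\<close>
  they agree everywhere. This applies to the image of an epimorphism and to the joint image of the
  coprojections of a coproduct.\<close>

lemma invariant_subset_eq:
  fixes B :: "('u::infinite, 'g) gset" and G :: "('g, 'a) monoid_scheme"
  assumes G: "group G" and B: "B \<in> Ob (Fin G)" and M: "M \<subseteq> points B"
    and inv: "\<And>b g. b \<in> M \<Longrightarrow> g \<in> carrier G \<Longrightarrow> ract B b g \<in> M"
    and eq: "\<And>(Z :: ('u, 'g) gset) u v. Z \<in> Ob (Fin G) \<Longrightarrow> u \<in> equivariant_maps G B Z \<Longrightarrow>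
      v \<in> equivariant_maps G B Z \<Longrightarrow> (\<forall>b\<in>M. u b = v b) \<Longrightarrow> u = v"
  shows "M = points B"
proof -
  interpret group G by fact
  define T :: "(bool, 'g) gset" where
    "T = \<lparr>points = UNIV, ract = (\<lambda>s g. if g \<in> carrier G then s else undefined)\<rparr>"
  have "right_gset G T" "finite (points T)" by (auto simp: T_def right_gset_def)
  then obtain Z :: "('u, 'g) gset" and e where Z: "Z \<in> Ob (Fin G)" "bij_betw e (points T) (points Z)"
    and e: "\<And>t g. t \<in> points T \<Longrightarrow> g \<in> carrier G \<Longrightarrow> e (ract T t g) = ract Z (e t) g"
    using G by (rule gset_transport) (rule that)
  have e': "ract Z (e t) g = e t" if "g \<in> carrier G" for t g
    using e[of t g] that by (simp add: T_def)
  have eZ: "e t \<in> points Z" for t using Z(2) by (auto simp: T_def bij_betw_def)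
  have einj: "e t = e t' \<longleftrightarrow> t = t'" for t t'
    using Z(2) by (auto simp: T_def bij_betw_def inj_on_def)
  have iff: "ract B b g \<in> M \<longleftrightarrow> b \<in> M" if b: "b \<in> points B" and g: "g \<in> carrier G" for b g
  proof
    assume "ract B b g \<in> M"
    then have "ract B (ract B b g) (inv\<^bsub>G\<^esub> g) \<in> M" using g by (simp add: inv)
    then show "b \<in> M" using B b g by (simp add: ract_mult[symmetric] ract_one)
  qed (use inv g in auto)
  define u where "u = (\<lambda>b\<in>points B. e True)"
  define v where "v = (\<lambda>b\<in>points B. e (b \<in> M))"
  have "u = v"
  proof (rule eq[OF Z(1)])
    show "u \<in> equivariant_maps G B Z" "v \<in> equivariant_maps G B Z"
      using B by (auto intro!: equivariant_mapsI simp: u_def v_def ract_closed eZ e' iff)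
    show "\<forall>b\<in>M. u b = v b" using M by (auto simp: u_def v_def)
  qed
  then have "u b = v b" for b by simp
  then have "e True = e (b \<in> M)" if "b \<in> points B" for b
    using that unfolding u_def v_def by (metis restrict_apply')
  then have "b \<in> M" if "b \<in> points B" for b
    using that unfolding einj by blast
  then show ?thesis using M by blast
qed

lemma is_epi_Fin_iff:
  fixes A B :: "('u::infinite, 'g) gset" and G :: "('g, 'a) monoid_scheme"
  assumes G: "group G"
  shows "is_epi (Fin G) A B f \<longleftrightarrow>
    A \<in> Ob (Fin G) \<and> B \<in> Ob (Fin G) \<and> f \<in> equivariant_maps G A B \<and> f ` points A = points B"
    (is "_ \<longleftrightarrow> ?R")
proof
  assume "is_epi (Fin G) A B f"
  then have A: "A \<in> Ob (Fin G)" and B: "B \<in> Ob (Fin G)" and f: "f \<in> equivariant_maps G A B"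
    and epi: "\<forall>(Z :: ('u, 'g) gset)\<in>Ob (Fin G). \<forall>u\<in>equivariant_maps G B Z. \<forall>v\<in>equivariant_maps G B Z.
      compose (points A) u f = compose (points A) v f \<longrightarrow> u = v"
    by (simp_all add: is_epi_def Hom_Fin Cmp_Fin)
  have "f ` points A = points B"
  proof (rule invariant_subset_eq[OF G B])
    show "f ` points A \<subseteq> points B" using equivariant_maps_closed[OF f] by auto
    show "ract B b g \<in> f ` points A" if "b \<in> f ` points A" "g \<in> carrier G" for b g
      using that ract_closed[OF A] by (auto simp: equivariant_maps_ract[OF f, symmetric])
    show "u = v" if "Z \<in> Ob (Fin G)" "u \<in> equivariant_maps G B Z" "v \<in> equivariant_maps G B Z"
      "\<forall>b\<in>f ` points A. u b = v b" for Z :: "('u, 'g) gset" and u v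
      using that by (intro epi[rule_format, of Z u v]) (auto simp: compose_def)
  qed
  then show ?R using A B f by simp
next
  assume r: ?R
  then show "is_epi (Fin G) A B f"
    unfolding is_epi_def Hom_Fin Cmp_Fin
  proof (intro conjI ballI impI)
    fix Z u v
    assume uv: "u \<in> equivariant_maps G B Z" "v \<in> equivariant_maps G B Z"
      "compose (points A) u f = compose (points A) v f"
    show "u = v"
    proof (rule equivariant_maps_eqI[OF uv(1,2)])
      fix b assume "b \<in> points B"
      then obtain a where "a \<in> points A" "b = f a" using r by blast
      then show "u b = v b" using fun_cong[OF uv(3), of a] by (simp add: compose_eq)
    qed
  qed auto
qed

text \<open>Points are the same as maps out of the free orbit. Hence the universal property of a pullback,
  tested on the free orbit alone, already identifies its points with the pairs of points that agree
  in \<open>D\<close>.\<close>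

lemma is_pullback_Fin_iff:
  fixes A B D P :: "('u::infinite, 'g) gset" and G :: "('g, 'a) monoid_scheme"
  assumes G: "group G" and fin: "finite (carrier G)"
  shows "is_pullback (Fin G) A B D P f g p q \<longleftrightarrow>
    (A \<in> Ob (Fin G) \<and> B \<in> Ob (Fin G) \<and> D \<in> Ob (Fin G) \<and> P \<in> Ob (Fin G) \<and>
    f \<in> equivariant_maps G A D \<and> g \<in> equivariant_maps G B D \<and>
    p \<in> equivariant_maps G P A \<and> q \<in> equivariant_maps G P B) \<and>
    bij_betw (\<lambda>z. (p z, q z)) (points P) {(a, b) \<in> points A \<times> points B. f a = g b}"
    (is "?L \<longleftrightarrow> ?C \<and> bij_betw ?pq _ ?Q")
proof
  assume L: ?L
  then have C: ?C
    and com: "compose (points P) f p = compose (points P) g q"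
    and univ: "\<forall>(Z :: ('u, 'g) gset)\<in>Ob (Fin G). \<forall>a\<in>equivariant_maps G Z A. \<forall>b\<in>equivariant_maps G Z B.
      compose (points Z) f a = compose (points Z) g b \<longrightarrow>
      (\<exists>!u. u \<in> equivariant_maps G Z P \<and> compose (points Z) p u = a \<and> compose (points Z) q u = b)"
    by (simp_all add: is_pullback_def Hom_Fin Cmp_Fin)
  obtain R :: "('u, 'g) gset" and r where "free_orbit G R r"
    using free_orbit_exists[OF G fin] by blast
  then interpret free_orbit G R r .
  have com': "f (p z) = g (q z)" if "z \<in> points P" for z
    using fun_cong[OF com, of z] that by (simp add: compose_eq)
  have ex1: "\<exists>!z. z \<in> points P \<and> p z = a \<and> q z = b"
    if ab: "a \<in> points A" "b \<in> points B" "f a = g b" for a b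
  proof -
    have "compose (points R) f (orbit_map A a) = compose (points R) g (orbit_map B b)"
      using compose_orbit_map[of A a f D] compose_orbit_map[of B b g D] C ab by simp
    from univ[rule_format, OF R _ _ this] C ab obtain u where
      u: "u \<in> equivariant_maps G R P" "compose (points R) p u = orbit_map A a"
        "compose (points R) q u = orbit_map B b"
      and uniq: "\<And>u'. u' \<in> equivariant_maps G R P \<Longrightarrow> compose (points R) p u' = orbit_map A a \<Longrightarrow>
        compose (points R) q u' = orbit_map B b \<Longrightarrow> u' = u"
      by (metis orbit_map_hom)
    show ?thesis
    proof (rule ex1I[of _ "u r"])
      show "u r \<in> points P \<and> p (u r) = a \<and> q (u r) = b"
        using fun_cong[OF u(2), of r] fun_cong[OF u(3), of r] equivariant_maps_closed[OF u(1) r0]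
          r0 C ab by (simp add: compose_eq orbit_map_base)
      fix z assume z: "z \<in> points P \<and> p z = a \<and> q z = b"
      then have "orbit_map P z = u"
        using C compose_orbit_map[of P z p A] compose_orbit_map[of P z q B]
        by (intro uniq orbit_map_hom) auto
      then show "z = u r" using orbit_map_base[of P z] z C by auto
    qed
  qed
  have "bij_betw ?pq (points P) ?Q"
    unfolding bij_betw_def
  proof
    have inQ: "?pq z \<in> ?Q" if "z \<in> points P" for z
      using that C com' by (auto intro: equivariant_maps_closed)
    show "inj_on ?pq (points P)"
    proof (rule inj_onI)
      fix z z' assume z: "z \<in> points P" "z' \<in> points P" "?pq z = ?pq z'"
      have "p z \<in> points A" "q z \<in> points B" "f (p z) = g (q z)" using inQ[OF z(1)] by auto
      from ex1[OF this] z show "z = z'" by (metis prod.inject)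
    qed
    show "?pq ` points P = ?Q"
    proof
      show "?Q \<subseteq> ?pq ` points P"
      proof clarify
        fix a b assume "a \<in> points A" "b \<in> points B" "f a = g b"
        then obtain z where "z \<in> points P" "p z = a" "q z = b" using ex1 by metis
        then show "(a, b) \<in> ?pq ` points P" by blast
      qed
    qed (use inQ in blast)
  qed
  then show "?C \<and> bij_betw ?pq (points P) ?Q" using C by blast
next
  assume r: "?C \<and> bij_betw ?pq (points P) ?Q"
  then have bij: "bij_betw ?pq (points P) ?Q" and C: ?C by blast+
  have com: "compose (points P) f p = compose (points P) g q"
    using bij by (auto simp: compose_def bij_betw_def fun_eq_iff)
  have inj: "z = z'" if "z \<in> points P" "z' \<in> points P" "p z = p z'" "q z = q z'" for z z'
    using bij that by (auto simp: bij_betw_def inj_on_def)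
  have "\<exists>!u. u \<in> equivariant_maps G Z P \<and> compose (points Z) p u = a \<and> compose (points Z) q u = b"
    if Z: "Z \<in> Ob (Fin G)" and a: "a \<in> equivariant_maps G Z A" and b: "b \<in> equivariant_maps G Z B"
      and eq: "compose (points Z) f a = compose (points Z) g b" for Z :: "('u, 'g) gset" and a b
  proof -
    have "(a z, b z) \<in> ?pq ` points P" if "z \<in> points Z" for z
      using that bij fun_cong[OF eq, of z] equivariant_maps_closed[OF a] equivariant_maps_closed[OF b]
      by (auto simp: bij_betw_def compose_eq)
    then obtain w where w: "\<And>z. z \<in> points Z \<Longrightarrow> w z \<in> points P \<and> p (w z) = a z \<and> q (w z) = b z"
      unfolding image_iff by (metis prod.inject)
    define u where "u = restrict w (points Z)"
    have u: "u z \<in> points P" "p (u z) = a z" "q (u z) = b z" if "z \<in> points Z" for z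
      using w that by (auto simp: u_def)
    have "u \<in> equivariant_maps G Z P"
    proof (rule equivariant_mapsI)
      fix z g assume z: "z \<in> points Z" "g \<in> carrier G"
      show "u (ract Z z g) = ract P (u z) g"
        using z Z C u ract_closed[OF Z z] a b
        by (intro inj[of "u (ract Z z g)" "ract P (u z) g"]) (auto simp: ract_closed equivariant_maps_ract)
    qed (use u in \<open>auto simp: u_def\<close>)
    moreover have "compose (points Z) p u = a" "compose (points Z) q u = b"
      by (rule extensionalityI[OF compose_extensional equivariant_maps_extensional[OF a]],
          simp add: u compose_eq)
        (rule extensionalityI[OF compose_extensional equivariant_maps_extensional[OF b]],
          simp add: u compose_eq)
    moreover have "u' = u" if u': "u' \<in> equivariant_maps G Z P" "compose (points Z) p u' = a"
      "compose (points Z) q u' = b" for u'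
    proof (rule equivariant_maps_eqI[OF u'(1) calculation(1)])
      fix z assume z: "z \<in> points Z"
      show "u' z = u z"
        using fun_cong[OF u'(2), of z] fun_cong[OF u'(3), of z] z u
        by (intro inj[of "u' z" "u z"]) (auto simp: compose_eq equivariant_maps_closed[OF u'(1)])
    qed
    ultimately show ?thesis by blast
  qed
  then show ?L using C com by (simp add: is_pullback_def Hom_Fin Cmp_Fin)
qed

lemma is_coproduct_FinI:
  fixes A :: "'i \<Rightarrow> ('u, 'g) gset" and G :: "('g, 'a) monoid_scheme"
  assumes A: "\<And>i. i \<in> I \<Longrightarrow> A i \<in> Ob (Fin G)" and K: "K \<in> Ob (Fin G)"
    and j: "\<And>i. i \<in> I \<Longrightarrow> j i \<in> equivariant_maps G (A i) K"
    and bij: "bij_betw (\<lambda>(i, a). j i a) (SIGMA i:I. points (A i)) (points K)"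
  shows "is_coproduct (Fin G) I A K j"
proof -
  have "\<exists>!u. u \<in> equivariant_maps G K Z \<and> (\<forall>i\<in>I. compose (points (A i)) u (j i) = f i)"
    if f: "\<forall>i\<in>I. f i \<in> equivariant_maps G (A i) Z" for Z :: "('u, 'g) gset" and f
  proof -
    define d where "d = the_inv_into (SIGMA i:I. points (A i)) (\<lambda>(i, a). j i a)"
    have d: "d (j i a) = (i, a)" if "i \<in> I" "a \<in> points (A i)" for i a
      using the_inv_into_f_f[OF bij_betw_imp_inj_on[OF bij], of "(i, a)"] that by (simp add: d_def)
    have KE: "\<exists>i a. i \<in> I \<and> a \<in> points (A i) \<and> k = j i a" if "k \<in> points K" for k
      using bij_betw_imp_surj_on[OF bij] that by force
    define u where "u = (\<lambda>k\<in>points K. (\<lambda>(i, a). f i a) (d k))"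
    have u: "u (j i a) = f i a" if "i \<in> I" "a \<in> points (A i)" for i a
      using that d equivariant_maps_closed[OF j[OF that(1)]] by (simp add: u_def)
    have "u \<in> equivariant_maps G K Z"
    proof (rule equivariant_mapsI)
      fix k assume "k \<in> points K"
      then obtain i a where k: "i \<in> I" "a \<in> points (A i)" "k = j i a" using KE by blast
      then show "u k \<in> points Z" using f u by (auto intro: equivariant_maps_closed)
      fix g assume g: "g \<in> carrier G"
      have "u (ract K k g) = u (j i (ract (A i) a g))"
        using k g by (simp add: equivariant_maps_ract[OF j])
      also have "\<dots> = ract Z (u k) g"
        using k g f equivariant_maps_ract[of "f i" G "A i" Z]
        by (simp add: u ract_closed[OF A])
      finally show "u (ract K k g) = ract Z (u k) g" .
    qed (simp add: u_def)
    moreover have "compose (points (A i)) u (j i) = f i" if "i \<in> I" for i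
      by (rule extensionalityI[OF compose_extensional])
        (use f that u in \<open>auto simp: compose_eq intro: equivariant_maps_extensional\<close>)
    moreover have "u' = u" if u': "u' \<in> equivariant_maps G K Z"
      "\<forall>i\<in>I. compose (points (A i)) u' (j i) = f i" for u'
    proof (rule equivariant_maps_eqI[OF u'(1) calculation(1)])
      fix k assume "k \<in> points K"
      then obtain i a where k: "i \<in> I" "a \<in> points (A i)" "k = j i a" using KE by blast
      then show "u' k = u k"
        using u fun_cong[OF bspec[OF u'(2) k(1)], of a] by (simp add: compose_eq)
    qed
    ultimately show ?thesis by blast
  qed
  then show ?thesis
    using A K j by (simp add: is_coproduct_def Hom_Fin Cmp_Fin)
qed

lemma disjoint_union_exists:
  fixes A :: "'i \<Rightarrow> ('u::infinite, 'g) gset" and G :: "('g, 'a) monoid_scheme"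
  assumes G: "group G" and I: "finite I" and A: "\<And>i. i \<in> I \<Longrightarrow> A i \<in> Ob (Fin G)"
  obtains K :: "('u, 'g) gset" and j where "K \<in> Ob (Fin G)" "\<And>i. i \<in> I \<Longrightarrow> j i \<in> equivariant_maps G (A i) K"
    "bij_betw (\<lambda>(i, a). j i a) (SIGMA i:I. points (A i)) (points K)"
proof -
  interpret group G by fact
  define T where "T = \<lparr>points = (SIGMA i:I. points (A i)),
    ract = (\<lambda>(i, a) g. if i \<in> I \<and> a \<in> points (A i) \<and> g \<in> carrier G
      then (i, ract (A i) a g) else undefined)\<rparr>"
  have "right_gset G T" "finite (points T)"
    using I A by (auto simp: T_def right_gset_def Ob_Fin)
  then obtain K :: "('u, 'g) gset" and e where K: "K \<in> Ob (Fin G)"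
    and bij: "bij_betw e (points T) (points K)"
    and e: "\<And>t g. t \<in> points T \<Longrightarrow> g \<in> carrier G \<Longrightarrow> e (ract T t g) = ract K (e t) g"
    using G by (rule gset_transport) (rule that)
  define j where "j i = (\<lambda>a\<in>points (A i). e (i, a))" for i
  have "j i \<in> equivariant_maps G (A i) K" if i: "i \<in> I" for i
  proof (rule equivariant_mapsI)
    fix a assume a: "a \<in> points (A i)"
    show "j i a \<in> points K" using bij a i by (auto simp: T_def j_def bij_betw_def)
    fix g assume "g \<in> carrier G"
    then show "j i (ract (A i) a g) = ract K (j i a) g"
      using e[of "(i, a)" g] a i ract_closed[OF A] by (simp add: T_def j_def)
  qed (simp add: j_def)
  moreover have "bij_betw (\<lambda>(i, a). j i a) (SIGMA i:I. points (A i)) (points K)"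
    using bij by (subst bij_betw_cong[where g = e]) (auto simp: T_def j_def)
  ultimately show thesis by (rule that[OF K])
qed

text \<open>The map from a coproduct to an actual disjoint union shows that the coprojections are injective
  with disjoint images. Their joint image is everything, because maps out of the coproduct are
  determined by their restrictions to it.\<close>

lemma is_coproduct_Fin_iff:
  fixes A :: "'i \<Rightarrow> ('u::infinite, 'g) gset" and G :: "('g, 'a) monoid_scheme"
  assumes G: "group G" and I: "finite I"
  shows "is_coproduct (Fin G) I A K j \<longleftrightarrow>
    (\<forall>i\<in>I. A i \<in> Ob (Fin G)) \<and> K \<in> Ob (Fin G) \<and> (\<forall>i\<in>I. j i \<in> equivariant_maps G (A i) K) \<and>
    bij_betw (\<lambda>(i, a). j i a) (SIGMA i:I. points (A i)) (points K)"
    (is "?L \<longleftrightarrow> ?R")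
proof
  assume L: ?L
  then have A': "\<forall>i\<in>I. A i \<in> Ob (Fin G)" and K: "K \<in> Ob (Fin G)"
    and j': "\<forall>i\<in>I. j i \<in> equivariant_maps G (A i) K"
    and univ: "\<forall>(Z :: ('u, 'g) gset)\<in>Ob (Fin G). \<forall>f. (\<forall>i\<in>I. f i \<in> equivariant_maps G (A i) Z) \<longrightarrow>
      (\<exists>!u. u \<in> equivariant_maps G K Z \<and> (\<forall>i\<in>I. compose (points (A i)) u (j i) = f i))"
    by (simp_all add: is_coproduct_def Hom_Fin Cmp_Fin)
  have A: "A i \<in> Ob (Fin G)" and j: "j i \<in> equivariant_maps G (A i) K" if "i \<in> I" for i
    using A' j' that by blast+
  let ?D = "SIGMA i:I. points (A i)"
  obtain K' :: "('u, 'g) gset" and j' where K': "K' \<in> Ob (Fin G)" and j': "\<And>i. i \<in> I \<Longrightarrow> j' i \<in> equivariant_maps G (A i) K'"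
    and bij': "bij_betw (\<lambda>(i, a). j' i a) ?D (points K')"
    using disjoint_union_exists[where A = A, OF G I A] by blast
  obtain u where u: "\<And>i. i \<in> I \<Longrightarrow> compose (points (A i)) u (j i) = j' i"
    using bspec[OF univ K', THEN spec, of j'] j' by blast
  have u': "u (j i a) = j' i a" if "i \<in> I" "a \<in> points (A i)" for i a
    using fun_cong[OF u[OF that(1)], of a] that by (simp add: compose_eq)
  have "inj_on (\<lambda>(i, a). j i a) ?D"
  proof (rule inj_onI, clarify)
    fix i a i' a' assume *: "i \<in> I" "a \<in> points (A i)" "i' \<in> I" "a' \<in> points (A i')" "j i a = j i' a'"
    then have "j' i a = j' i' a'" using u' by metis
    then have "(i, a) = (i', a')"
      using * inj_onD[OF bij_betw_imp_inj_on[OF bij'], of "(i, a)" "(i', a')"] by simp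
    then show "i = i' \<and> a = a'" by simp
  qed
  moreover have "(\<lambda>(i, a). j i a) ` ?D = points K"
  proof (rule invariant_subset_eq[OF G K])
    show "(\<lambda>(i, a). j i a) ` ?D \<subseteq> points K" using j by (auto intro: equivariant_maps_closed)
    fix b g assume "b \<in> (\<lambda>(i, a). j i a) ` ?D" and g: "g \<in> carrier G"
    then obtain i a where b: "i \<in> I" "a \<in> points (A i)" "b = j i a" by auto
    then have "ract K b g = (\<lambda>(i, a). j i a) (i, ract (A i) a g)"
      using g by (simp add: equivariant_maps_ract[OF j])
    moreover have "(i, ract (A i) a g) \<in> ?D" using b g by (simp add: ract_closed[OF A])
    ultimately show "ract K b g \<in> (\<lambda>(i, a). j i a) ` ?D" by (rule image_eqI)
  next
    fix Z :: "('u, 'g) gset" and v w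
    assume *: "Z \<in> Ob (Fin G)" "v \<in> equivariant_maps G K Z" "w \<in> equivariant_maps G K Z"
      "\<forall>b\<in>(\<lambda>(i, a). j i a) ` ?D. v b = w b"
    have "\<exists>!u. u \<in> equivariant_maps G K Z \<and>
        (\<forall>i\<in>I. compose (points (A i)) u (j i) = compose (points (A i)) v (j i))"
      using * equivariant_maps_compose[OF A j *(2)] by (intro univ[rule_format]) auto
    moreover have "compose (points (A i)) w (j i) = compose (points (A i)) v (j i)" if "i \<in> I" for i
      using * that by (auto simp: compose_def fun_eq_iff)
    ultimately show "v = w" using * by blast
  qed
  ultimately show ?R using A K j by (simp add: bij_betw_def)
qed (blast intro: is_coproduct_FinI)


section \<open>Presentations of a functor as a tensor product\<close>

locale fin_functor = G: group G + H: group H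
  for G :: "('g, 'a) monoid_scheme" and H :: "('h, 'b) monoid_scheme" +
  fixes F :: "(('u::infinite, 'g) gset, 'u \<Rightarrow> 'u, ('v::infinite, 'h) gset, 'v \<Rightarrow> 'v) cfunctor"
  assumes finite_G: "finite (carrier G)" and finite_H: "finite (carrier H)"
    and is_functor: "is_functor (Fin G) (Fin H) F"
begin

lemma omap_Ob: "S \<in> Ob (Fin G) \<Longrightarrow> omap F S \<in> Ob (Fin H)"
  using is_functor by (simp add: is_functor_def)

lemma amap_hom: "S \<in> Ob (Fin G) \<Longrightarrow> T \<in> Ob (Fin G) \<Longrightarrow> f \<in> equivariant_maps G S T \<Longrightarrow>
    amap F S T f \<in> equivariant_maps H (omap F S) (omap F T)"
  using is_functor by (simp add: is_functor_def Hom_Fin)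

lemma amap_closed: "S \<in> Ob (Fin G) \<Longrightarrow> T \<in> Ob (Fin G) \<Longrightarrow> f \<in> equivariant_maps G S T \<Longrightarrow>
    y \<in> points (omap F S) \<Longrightarrow> amap F S T f y \<in> points (omap F T)"
  by (rule equivariant_maps_closed[OF amap_hom])

lemma amap_id: "S \<in> Ob (Fin G) \<Longrightarrow> y \<in> points (omap F S) \<Longrightarrow> amap F S S (\<lambda>s\<in>points S. s) y = y"
  using is_functor by (simp add: is_functor_def Ide_Fin)

lemma amap_compose: "S \<in> Ob (Fin G) \<Longrightarrow> T \<in> Ob (Fin G) \<Longrightarrow> U \<in> Ob (Fin G) \<Longrightarrow>
    f \<in> equivariant_maps G S T \<Longrightarrow> g \<in> equivariant_maps G T U \<Longrightarrow> y \<in> points (omap F S) \<Longrightarrow>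
    amap F S U (compose (points S) g f) y = amap F T U g (amap F S T f y)"
  using is_functor by (simp add: is_functor_def Hom_Fin Cmp_Fin compose_eq)

end

text \<open>A natural isomorphism with \<open>- \<times>\<^sub>G X\<close>, written without equivalence classes: \<open>\<kappa> S s x\<close> is the
  point of \<open>F S\<close> that corresponds to the class of \<open>(s, x)\<close>.\<close>

locale tensor_presentation = fin_functor G H F
  for G :: "('g, 'a) monoid_scheme" and H :: "('h, 'b) monoid_scheme"
    and F :: "(('u::infinite, 'g) gset, 'u \<Rightarrow> 'u, ('v::infinite, 'h) gset, 'v \<Rightarrow> 'v) cfunctor" +
  fixes X :: "('x, 'h, 'g) biset" and \<kappa> :: "('u, 'g) gset \<Rightarrow> 'u \<Rightarrow> 'x \<Rightarrow> 'v"
  assumes X: "X \<in> FinBiset G H"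
    and kappa_closed: "S \<in> Ob (Fin G) \<Longrightarrow> s \<in> points S \<Longrightarrow> x \<in> points X \<Longrightarrow> \<kappa> S s x \<in> points (omap F S)"
    and kappa_surj: "S \<in> Ob (Fin G) \<Longrightarrow> y \<in> points (omap F S) \<Longrightarrow>
      \<exists>s x. s \<in> points S \<and> x \<in> points X \<and> y = \<kappa> S s x"
    and kappa_eq: "S \<in> Ob (Fin G) \<Longrightarrow> s \<in> points S \<Longrightarrow> x \<in> points X \<Longrightarrow> t \<in> points S \<Longrightarrow> x' \<in> points X \<Longrightarrow>
      \<kappa> S s x = \<kappa> S t x' \<longleftrightarrow> (\<exists>g\<in>carrier G. s = ract S t g \<and> x' = lact X g x)"
    and kappa_ract: "S \<in> Ob (Fin G) \<Longrightarrow> s \<in> points S \<Longrightarrow> x \<in> points X \<Longrightarrow> h \<in> carrier H \<Longrightarrow>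
      \<kappa> S s (ract X x h) = ract (omap F S) (\<kappa> S s x) h"
    and amap_kappa: "S \<in> Ob (Fin G) \<Longrightarrow> T \<in> Ob (Fin G) \<Longrightarrow> f \<in> equivariant_maps G S T \<Longrightarrow>
      s \<in> points S \<Longrightarrow> x \<in> points X \<Longrightarrow> amap F S T f (\<kappa> S s x) = \<kappa> T (f s) x"
begin

lemma lact_inj:
  assumes "g \<in> carrier G" "h \<in> carrier G" "x \<in> points X" "lact X g x = lact X h x"
  shows "g = h"
proof -
  interpret X: group_action G "points X" "lact X" using X by (simp add: FinBiset_def)
  have "lact X (inv\<^bsub>G\<^esub> h \<otimes>\<^bsub>G\<^esub> g) x = lact X (inv\<^bsub>G\<^esub> h) (lact X h x)"
    using assms X.composition_rule[of x "inv\<^bsub>G\<^esub> h" g] by simp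
  also have "\<dots> = x"
    using assms by (intro X.orbit_sym_aux) simp_all
  finally have "inv\<^bsub>G\<^esub> h \<otimes>\<^bsub>G\<^esub> g = \<one>\<^bsub>G\<^esub>"
    using X assms by (simp add: FinBiset_def)
  then show ?thesis using assms by (metis G.inv_equality G.inv_closed G.inv_inv)
qed

lemma epis: "preserves_epis (Fin G) (Fin H) F"
  unfolding preserves_epis_def is_epi_Fin_iff[OF G.is_group] is_epi_Fin_iff[OF H.is_group]
proof (intro allI impI, elim conjE, intro conjI)
  fix A B :: "('u, 'g) gset" and f assume A: "A \<in> Ob (Fin G)" and B: "B \<in> Ob (Fin G)" and f: "f \<in> equivariant_maps G A B"
    and surj: "f ` points A = points B"
  show "amap F A B f ` points (omap F A) = points (omap F B)"
  proof
    show "points (omap F B) \<subseteq> amap F A B f ` points (omap F A)"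
    proof
      fix y assume "y \<in> points (omap F B)"
      then obtain a x where "a \<in> points A" "x \<in> points X" "y = \<kappa> B (f a) x"
        using kappa_surj[OF B] surj by (metis imageE)
      then show "y \<in> amap F A B f ` points (omap F A)"
        using amap_kappa[OF A B f] kappa_closed[OF A] by (metis imageI)
    qed
  qed (use amap_closed[OF A B f] in blast)
qed (auto intro: omap_Ob amap_hom)

text \<open>Let \<open>(z, x)\<close> and \<open>(z', x')\<close> represent two points with the same projections. Then \<open>x' = c x = d x\<close>
  for group elements \<open>c\<close> and \<open>d\<close> with \<open>p z = p z' c\<close> and \<open>q z = q z' d\<close>. Freeness of the left action
  gives \<open>c = d\<close>, and so \<open>z = z' c\<close>.\<close>

lemma pullbacks: "preserves_pullbacks (Fin G) (Fin H) F"
  unfolding preserves_pullbacks_def is_pullback_Fin_iff[OF G.is_group finite_G]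
    is_pullback_Fin_iff[OF H.is_group finite_H]
proof (intro allI impI, elim conjE, intro conjI)
  fix A B E P :: "('u, 'g) gset" and f g p q
  assume Ob: "A \<in> Ob (Fin G)" "B \<in> Ob (Fin G)" "E \<in> Ob (Fin G)" "P \<in> Ob (Fin G)"
    and f: "f \<in> equivariant_maps G A E" and g: "g \<in> equivariant_maps G B E"
    and p: "p \<in> equivariant_maps G P A" and q: "q \<in> equivariant_maps G P B"
    and bij: "bij_betw (\<lambda>z. (p z, q z)) (points P) {(a, b) \<in> points A \<times> points B. f a = g b}"
  let ?p = "amap F P A p" and ?q = "amap F P B q" and ?f = "amap F A E f" and ?g = "amap F B E g"
  have pz: "p z \<in> points A" and qz: "q z \<in> points B" if "z \<in> points P" for z
    using that p q by (auto intro: equivariant_maps_closed)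
  have com: "f (p z) = g (q z)" if "z \<in> points P" for z
    using bij that by (auto simp: bij_betw_def)
  note amap_p = amap_kappa[OF Ob(4,1) p] and amap_q = amap_kappa[OF Ob(4,2) q]
    and amap_f = amap_kappa[OF Ob(1,3) f] and amap_g = amap_kappa[OF Ob(2,3) g]
  show "bij_betw (\<lambda>w. (?p w, ?q w)) (points (omap F P))
      {(y, y') \<in> points (omap F A) \<times> points (omap F B). ?f y = ?g y'}" (is "bij_betw ?h _ ?Q")
    unfolding bij_betw_def
  proof
    show "inj_on ?h (points (omap F P))"
    proof (rule inj_onI, elim Pair_inject)
      fix w w' assume w: "w \<in> points (omap F P)" "w' \<in> points (omap F P)" "?p w = ?p w'" "?q w = ?q w'"
      obtain z x where z: "z \<in> points P" "x \<in> points X" "w = \<kappa> P z x"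
        using kappa_surj[OF Ob(4) w(1)] by blast
      obtain z' x' where z': "z' \<in> points P" "x' \<in> points X" "w' = \<kappa> P z' x'"
        using kappa_surj[OF Ob(4) w(2)] by blast
      have "\<kappa> A (p z) x = \<kappa> A (p z') x'" "\<kappa> B (q z) x = \<kappa> B (q z') x'"
        using w z z' amap_p amap_q by auto
      then obtain c d where c: "c \<in> carrier G" "p z = ract A (p z') c" "x' = lact X c x"
        and d: "d \<in> carrier G" "q z = ract B (q z') d" "x' = lact X d x"
        using kappa_eq[OF Ob(1) pz[OF z(1)] z(2) pz[OF z'(1)] z'(2)]
            kappa_eq[OF Ob(2) qz[OF z(1)] z(2) qz[OF z'(1)] z'(2)] by blast
      have "c = d" using c d z lact_inj by metis
      then have "(p z, q z) = (p (ract P z' c), q (ract P z' c))"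
        using c d z' by (simp add: equivariant_maps_ract[OF p] equivariant_maps_ract[OF q])
      then have "z = ract P z' c"
        using inj_onD[OF bij_betw_imp_inj_on[OF bij]] z z' c ract_closed[OF Ob(4)] by blast
      then show "w = w'" using kappa_eq[OF Ob(4)] z z' c by blast
    qed
    show "?h ` points (omap F P) = ?Q"
    proof
      show "?h ` points (omap F P) \<subseteq> ?Q"
      proof (rule image_subsetI)
        fix w assume w: "w \<in> points (omap F P)"
        obtain z x where z: "z \<in> points P" "x \<in> points X" "w = \<kappa> P z x"
          using kappa_surj[OF Ob(4) w] by blast
        then show "?h w \<in> ?Q"
          using amap_p amap_q amap_f amap_g pz qz com kappa_closed Ob by auto
      qed
      show "?Q \<subseteq> ?h ` points (omap F P)"
      proof clarify
        fix y y' assume y: "y \<in> points (omap F A)" "y' \<in> points (omap F B)" "?f y = ?g y'"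
        obtain a x where a: "a \<in> points A" "x \<in> points X" "y = \<kappa> A a x"
          using kappa_surj[OF Ob(1) y(1)] by blast
        obtain b x' where b: "b \<in> points B" "x' \<in> points X" "y' = \<kappa> B b x'"
          using kappa_surj[OF Ob(2) y(2)] by blast
        have "\<kappa> E (f a) x = \<kappa> E (g b) x'"
          using y a b amap_f amap_g by auto
        then obtain c where c: "c \<in> carrier G" "f a = ract E (g b) c" "x' = lact X c x"
          using kappa_eq[OF Ob(3) equivariant_maps_closed[OF f a(1)] a(2)
              equivariant_maps_closed[OF g b(1)] b(2)] by blast
        \<comment> \<open>Moving \<open>c\<close> across the tensor sign makes the second components of both representatives equal.\<close>
        have bc: "ract B b c \<in> points B" using b c ract_closed[OF Ob(2)] by blast
        have "y' = \<kappa> B (ract B b c) x"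
          using kappa_eq[OF Ob(2) bc a(2) b(1,2)] b(3) c by metis
        moreover have "f a = g (ract B b c)"
          using b c by (simp add: equivariant_maps_ract[OF g])
        then obtain z where z: "z \<in> points P" "p z = a" "q z = ract B b c"
          using bij_betw_imp_surj_on[OF bij] a bc by force
        ultimately have "(y, y') = ?h (\<kappa> P z x)"
          using a amap_p amap_q by simp
        then show "(y, y') \<in> ?h ` points (omap F P)"
          using z a kappa_closed[OF Ob(4)] by blast
      qed
    qed
  qed
qed (auto intro: omap_Ob amap_hom)

lemma finite_coproducts: "preserves_finite_coproducts (Fin G) (Fin H) F"
  unfolding preserves_finite_coproducts_def
proof (intro allI impI)
  fix I :: "nat set" and A and K :: "('u, 'g) gset" and j
  assume I: "finite I" and cop: "is_coproduct (Fin G) I A K j"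
  let ?D = "SIGMA i:I. points (A i)" and ?E = "SIGMA i:I. points (omap F (A i))"
  let ?j = "\<lambda>i. amap F (A i) K (j i)"
  have A: "A i \<in> Ob (Fin G)" and j: "j i \<in> equivariant_maps G (A i) K" if "i \<in> I" for i
    using cop that by (simp_all add: is_coproduct_Fin_iff[OF G.is_group I])
  have K: "K \<in> Ob (Fin G)" and bij: "bij_betw (\<lambda>(i, a). j i a) ?D (points K)"
    using cop by (simp_all add: is_coproduct_Fin_iff[OF G.is_group I])
  have ja: "j i a \<in> points K" if "i \<in> I" "a \<in> points (A i)" for i a
    using j that by (blast intro: equivariant_maps_closed)
  show "is_coproduct (Fin H) I (\<lambda>i. omap F (A i)) (omap F K) ?j"
  proof (rule is_coproduct_FinI)
    show "bij_betw (\<lambda>(i, y). ?j i y) ?E (points (omap F K))"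
      unfolding bij_betw_def
    proof
      show "inj_on (\<lambda>(i, y). ?j i y) ?E"
      proof (rule inj_onI, clarify)
        fix i y i' y' assume i: "i \<in> I" "y \<in> points (omap F (A i))" "i' \<in> I"
          "y' \<in> points (omap F (A i'))" "?j i y = ?j i' y'"
        obtain a x where a: "a \<in> points (A i)" "x \<in> points X" "y = \<kappa> (A i) a x"
          using kappa_surj[OF A] i by blast
        obtain a' x' where a': "a' \<in> points (A i')" "x' \<in> points X" "y' = \<kappa> (A i') a' x'"
          using kappa_surj[OF A] i by blast
        have "\<kappa> K (j i a) x = \<kappa> K (j i' a') x'"
          using amap_kappa[OF A K j] i a a' by simp
        then obtain c where c: "c \<in> carrier G" "j i a = ract K (j i' a') c" "x' = lact X c x"
          using kappa_eq[OF K ja[OF i(1) a(1)] a(2) ja[OF i(3) a'(1)] a'(2)] by blast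
        have "(\<lambda>(i, a). j i a) (i, a) = (\<lambda>(i, a). j i a) (i', ract (A i') a' c)"
          using c i a' by (simp add: equivariant_maps_ract[OF j])
        then have "(i, a) = (i', ract (A i') a' c)"
          by (rule inj_onD[OF bij_betw_imp_inj_on[OF bij]]) (use i a a' c ract_closed[OF A] in auto)
        then show "i = i' \<and> y = y'"
          using kappa_eq[OF A] i a a' c by blast
      qed
      show "(\<lambda>(i, y). ?j i y) ` ?E = points (omap F K)"
      proof
        show "(\<lambda>(i, y). ?j i y) ` ?E \<subseteq> points (omap F K)"
          using amap_closed[OF A K j] by auto
        show "points (omap F K) \<subseteq> (\<lambda>(i, y). ?j i y) ` ?E"
        proof
          fix y assume y: "y \<in> points (omap F K)"
          obtain k x where k: "k \<in> points K" "x \<in> points X" "y = \<kappa> K k x"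
            using kappa_surj[OF K y] by blast
          then obtain i a where i: "i \<in> I" "a \<in> points (A i)" "k = j i a"
            using bij_betw_imp_surj_on[OF bij] by force
          then have "y = (\<lambda>(i, y). ?j i y) (i, \<kappa> (A i) a x)"
            using k amap_kappa[OF A K j] by simp
          then show "y \<in> (\<lambda>(i, y). ?j i y) ` ?E"
            by (rule image_eqI) (use i k kappa_closed[OF A] in simp)
        qed
      qed
    qed
  qed (use A K j in \<open>auto intro: omap_Ob amap_hom\<close>)
qed

end

lemma (in fin_functor) tensor_presentation_of_iso:
  fixes X :: "('x, 'h, 'g) biset"
  assumes X: "X \<in> FinBiset G H" and iso: "naturally_isomorphic (Fin G) H F (tensor_functor G H X)"
  obtains \<kappa> where "tensor_presentation G H F X \<kappa>"
proof -
  let ?T = "tensor_gset G H X"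
  let ?c = "\<lambda>(S :: ('u, 'g) gset) s x. balanced_rel G S X `` {(s, x)}"
  have om: "omap (tensor_functor G H X :: (('u, 'g) gset, _, _, _) cfunctor) = ?T"
    by (simp add: tensor_functor_def)
  obtain \<eta> where \<eta>: "\<And>S. S \<in> Ob (Fin G) \<Longrightarrow> \<eta> S \<in> equivariant_maps H (omap F S) (?T S)"
    and bij: "\<And>S. S \<in> Ob (Fin G) \<Longrightarrow> bij_betw (\<eta> S) (points (omap F S)) (points (?T S))"
    and nat: "\<And>S T f y. S \<in> Ob (Fin G) \<Longrightarrow> T \<in> Ob (Fin G) \<Longrightarrow> f \<in> equivariant_maps G S T \<Longrightarrow>
      y \<in> points (omap F S) \<Longrightarrow> \<eta> T (amap F S T f y) = amap (tensor_functor G H X) S T f (\<eta> S y)"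
    using iso unfolding naturally_isomorphic_def Hom_Fin om by blast
  have XA: "group_action G (points X) (lact X)" and XR: "right_gset H X"
    using X by (simp_all add: FinBiset_def)
  have XRc: "ract X x h \<in> points X" if "x \<in> points X" "h \<in> carrier H" for x h
    using XR that by (simp add: right_gset_def)
  have S': "right_gset G S" if "S \<in> Ob (Fin G)" for S :: "('u, 'g) gset"
    using that by (simp add: Ob_Fin)
  have cT: "?c S s x \<in> points (?T S)" if "s \<in> points S" "x \<in> points X" for S s x
    using that by (simp add: points_tensor_gset quotientI)
  define \<kappa> where "\<kappa> S s x = the_inv_into (points (omap F S)) (\<eta> S) (?c S s x)" for S s x
  have \<kappa>: "\<kappa> S s x \<in> points (omap F S)" "\<eta> S (\<kappa> S s x) = ?c S s x"
    if "S \<in> Ob (Fin G)" "s \<in> points S" "x \<in> points X" for S s x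
    using that bij[OF that(1)] cT[of s S x]
      bij_betwE[OF bij_betw_the_inv_into[OF bij[OF that(1)]]]
      f_the_inv_into_f_bij_betw[OF bij[OF that(1)]] by (auto simp: \<kappa>_def)
  have \<eta>inj: "y = y'" if "S \<in> Ob (Fin G)" "y \<in> points (omap F S)" "y' \<in> points (omap F S)"
    "\<eta> S y = \<eta> S y'" for S y y'
    using bij_betw_imp_inj_on[OF bij[OF that(1)]] that by (blast dest: inj_onD)
  have "tensor_presentation G H F X \<kappa>"
  proof
    fix S :: "('u, 'g) gset" assume S: "S \<in> Ob (Fin G)"
    have eq: "equiv (points S \<times> points X) (balanced_rel G S X)"
      by (rule equiv_balanced_rel[OF G.is_group S'[OF S] XA])
    show "\<exists>s x. s \<in> points S \<and> x \<in> points X \<and> y = \<kappa> S s x" if y: "y \<in> points (omap F S)" for y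
    proof -
      have "\<eta> S y \<in> points (?T S)" using \<eta>[OF S] y by (rule equivariant_maps_closed)
      then obtain s x where "s \<in> points S" "x \<in> points X" "\<eta> S y = ?c S s x"
        unfolding points_tensor_gset by (auto elim!: quotientE)
      then show ?thesis using \<kappa>[OF S] \<eta>inj[OF S y] by metis
    qed
    fix s x assume s: "s \<in> points S" and x: "x \<in> points X"
    show "\<kappa> S s x \<in> points (omap F S)" by (rule \<kappa>(1)[OF S s x])
    show "\<kappa> S s x = \<kappa> S t y \<longleftrightarrow> (\<exists>g\<in>carrier G. s = ract S t g \<and> y = lact X g x)"
      if t: "t \<in> points S" and y: "y \<in> points X" for t y
    proof -
      have "\<kappa> S s x = \<kappa> S t y \<longleftrightarrow> ?c S s x = ?c S t y"
        using \<kappa>[OF S s x] \<kappa>[OF S t y] \<eta>inj[OF S] by metis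
      also have "\<dots> \<longleftrightarrow> ((s, x), (t, y)) \<in> balanced_rel G S X"
        using eq s x t y by (simp add: eq_equiv_class_iff)
      also have "\<dots> \<longleftrightarrow> (\<exists>g\<in>carrier G. s = ract S t g \<and> y = lact X g x)"
        using t x by (auto simp: balanced_rel_def)
      finally show ?thesis .
    qed
    show "\<kappa> S s (ract X x h) = ract (omap F S) (\<kappa> S s x) h" if h: "h \<in> carrier H" for h
    proof (rule \<eta>inj[OF S])
      show "\<eta> S (\<kappa> S s (ract X x h)) = \<eta> S (ract (omap F S) (\<kappa> S s x) h)"
        using \<kappa>[OF S s] x h XRc ract_tensor_gset[OF G.is_group S'[OF S] X s x h]
          equivariant_maps_ract[OF \<eta>[OF S]] by simp
    qed (use \<kappa>[OF S s] x h XRc ract_closed[OF omap_Ob[OF S]] in auto)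
    show "amap F S T f (\<kappa> S s x) = \<kappa> T (f s) x"
      if T: "T \<in> Ob (Fin G)" and f: "f \<in> equivariant_maps G S T" for T :: "('u, 'g) gset" and f
    proof (rule \<eta>inj[OF T])
      have fs: "f s \<in> points T" using f s by (rule equivariant_maps_closed)
      show "\<kappa> T (f s) x \<in> points (omap F T)" by (rule \<kappa>(1)[OF T fs x])
      show "amap F S T f (\<kappa> S s x) \<in> points (omap F T)"
        by (rule amap_closed[OF S T f \<kappa>(1)[OF S s x]])
      show "\<eta> T (amap F S T f (\<kappa> S s x)) = \<eta> T (\<kappa> T (f s) x)"
        using nat[OF S T f] \<kappa>[OF S s x] \<kappa>[OF T fs x]
          amap_tensor_functor[OF G.is_group S'[OF S] S'[OF T] X f s x] by simp
    qed
  qed (rule X)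
  then show thesis by (rule that)
qed

text \<open>The fibres of \<open>\<kappa> S\<close> are exactly the classes of the balanced relation, so sending a point of \<open>F S\<close>
  to its fibre gives the isomorphism.\<close>

lemma (in tensor_presentation) naturally_isomorphic:
  "naturally_isomorphic (Fin G) H F (tensor_functor G H X)"
proof -
  let ?T = "tensor_gset G H X"
  let ?c = "\<lambda>(S :: ('u, 'g) gset) s x. balanced_rel G S X `` {(s, x)}"
  have S': "right_gset G S" if "S \<in> Ob (Fin G)" for S :: "('u, 'g) gset"
    using that by (simp add: Ob_Fin)
  have XA: "group_action G (points X) (lact X)" and XR: "right_gset H X"
    using X by (simp_all add: FinBiset_def)
  have XRc: "ract X x h \<in> points X" if "x \<in> points X" "h \<in> carrier H" for x h
    using XR that by (simp add: right_gset_def)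
  have eq: "equiv (points S \<times> points X) (balanced_rel G S X)" if "S \<in> Ob (Fin G)" for S :: "('u, 'g) gset"
    by (rule equiv_balanced_rel[OF G.is_group S'[OF that] XA])
  define \<eta> where "\<eta> S = (\<lambda>w\<in>points (omap F S). {(s, x). s \<in> points S \<and> x \<in> points X \<and> \<kappa> S s x = w})" for S
  have \<eta>: "\<eta> S (\<kappa> S s x) = ?c S s x" if S: "S \<in> Ob (Fin G)" and s: "s \<in> points S" "x \<in> points X" for S s x
  proof -
    have "t \<in> points S \<and> y \<in> points X \<and> \<kappa> S t y = \<kappa> S s x \<longleftrightarrow> ((s, x), (t, y)) \<in> balanced_rel G S X" for t y
    proof -
      have "((s, x), (t, y)) \<in> balanced_rel G S X \<longrightarrow> t \<in> points S \<and> y \<in> points X"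
        using eq[OF S] by (auto simp: equiv_def)
      moreover have "t \<in> points S \<Longrightarrow> y \<in> points X \<Longrightarrow>
          \<kappa> S t y = \<kappa> S s x \<longleftrightarrow> ((s, x), (t, y)) \<in> balanced_rel G S X"
        using kappa_eq[OF S s, of t y] s unfolding balanced_rel_def by auto
      ultimately show ?thesis by blast
    qed
    then show ?thesis using kappa_closed[OF S s] by (auto simp: \<eta>_def)
  qed
  have hom: "\<eta> S \<in> equivariant_maps H (omap F S) (?T S)" if S: "S \<in> Ob (Fin G)" for S
  proof (rule equivariant_mapsI)
    fix w assume "w \<in> points (omap F S)"
    then obtain s x where w: "s \<in> points S" "x \<in> points X" "w = \<kappa> S s x" using kappa_surj[OF S] by blast
    then show "\<eta> S w \<in> points (?T S)" using \<eta>[OF S] by (simp add: points_tensor_gset quotientI)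
    fix h assume h: "h \<in> carrier H"
    have "\<eta> S (ract (omap F S) w h) = \<eta> S (\<kappa> S s (ract X x h))" using w h kappa_ract[OF S] by simp
    also have "\<dots> = ract (?T S) (\<eta> S w) h"
      using w h \<eta>[OF S] XRc ract_tensor_gset[OF G.is_group S'[OF S] X] by simp
    finally show "\<eta> S (ract (omap F S) w h) = ract (?T S) (\<eta> S w) h" .
  qed (simp add: \<eta>_def)
  have bij: "bij_betw (\<eta> S) (points (omap F S)) (points (?T S))" if S: "S \<in> Ob (Fin G)" for S
    unfolding bij_betw_def
  proof
    show "inj_on (\<eta> S) (points (omap F S))"
    proof (rule inj_onI)
      fix w w' assume w: "w \<in> points (omap F S)" "w' \<in> points (omap F S)" "\<eta> S w = \<eta> S w'"
      obtain s x where s: "s \<in> points S" "x \<in> points X" "w = \<kappa> S s x" using kappa_surj[OF S w(1)] by blast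
      then have "(s, x) \<in> \<eta> S w" using w(1) by (simp add: \<eta>_def)
      then have "(s, x) \<in> \<eta> S w'" using w(3) by simp
      then show "w = w'" using w(2) s(3) by (simp add: \<eta>_def)
    qed
    show "\<eta> S ` points (omap F S) = points (?T S)"
    proof
      show "\<eta> S ` points (omap F S) \<subseteq> points (?T S)" using equivariant_maps_closed[OF hom[OF S]] by blast
      show "points (?T S) \<subseteq> \<eta> S ` points (omap F S)"
      proof
        fix c assume "c \<in> points (?T S)"
        then obtain s x where "s \<in> points S" "x \<in> points X" "c = ?c S s x"
          unfolding points_tensor_gset by (auto elim!: quotientE)
        then show "c \<in> \<eta> S ` points (omap F S)" using \<eta>[OF S] kappa_closed[OF S] by (metis imageI)
      qed
    qed
  qed
  have "\<eta> T (amap F S T f w) = amap (tensor_functor G H X) S T f (\<eta> S w)"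
    if S: "S \<in> Ob (Fin G)" and T: "T \<in> Ob (Fin G)" and f: "f \<in> equivariant_maps G S T"
      and w: "w \<in> points (omap F S)" for S T f w
  proof -
    obtain s x where s: "s \<in> points S" "x \<in> points X" "w = \<kappa> S s x" using kappa_surj[OF S w] by blast
    then show ?thesis
      using \<eta>[OF S] \<eta>[OF T] amap_kappa[OF S T f] equivariant_maps_closed[OF f]
        amap_tensor_functor[OF G.is_group S'[OF S] S'[OF T] X f] by simp
  qed
  then show ?thesis
    unfolding naturally_isomorphic_def Hom_Fin
    by (intro exI[of _ \<eta>]) (use hom bij in \<open>auto simp: tensor_functor_def\<close>)
qed


section \<open>The biset of values on the free orbit\<close>

locale evaluated_functor = fin_functor G H F + free_orbit G R r\<^sub>0
  for G :: "('g, 'a) monoid_scheme" and H :: "('h, 'b) monoid_scheme"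
    and F :: "(('u::infinite, 'g) gset, 'u \<Rightarrow> 'u, ('v::infinite, 'h) gset, 'v \<Rightarrow> 'v) cfunctor"
    and R :: "('u, 'g) gset" and r\<^sub>0 :: 'u
begin

text \<open>Under the correspondence between points \<open>s\<close> of \<open>S\<close> and maps from \<open>R\<close> to \<open>S\<close>, functoriality of \<open>F\<close>
  gives a pairing of \<open>S\<close> with \<open>F R\<close> with values in \<open>F S\<close>. For \<open>S = R\<close> it is the left action of \<open>G\<close> on
  \<open>F R\<close>, because the map of \<open>R\<close> that sends \<open>r\<^sub>0\<close> to \<open>r\<^sub>0 g\<close> is left translation by \<open>g\<close>.\<close>

definition generated :: "('u, 'g) gset \<Rightarrow> 'u \<Rightarrow> 'v \<Rightarrow> 'v" where
  "generated S s = amap F R S (orbit_map S s)"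

definition value_biset :: "('v, 'h, 'g) biset" where
  "value_biset = \<lparr>points = points (omap F R), ract = ract (omap F R),
     lact = (\<lambda>g. generated R (ract R r\<^sub>0 g))\<rparr>"

lemma generated_hom: "S \<in> Ob (Fin G) \<Longrightarrow> s \<in> points S \<Longrightarrow>
    generated S s \<in> equivariant_maps H (omap F R) (omap F S)"
  unfolding generated_def by (intro amap_hom R orbit_map_hom)

lemma generated_closed: "S \<in> Ob (Fin G) \<Longrightarrow> s \<in> points S \<Longrightarrow> x \<in> points (omap F R) \<Longrightarrow>
    generated S s x \<in> points (omap F S)"
  by (rule equivariant_maps_closed[OF generated_hom])

lemma amap_generated:
  assumes "S \<in> Ob (Fin G)" "T \<in> Ob (Fin G)" "f \<in> equivariant_maps G S T" "s \<in> points S"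
    "x \<in> points (omap F R)"
  shows "amap F S T f (generated S s x) = generated T (f s) x"
  using amap_compose[OF R assms(1,2) orbit_map_hom[OF assms(1,4)] assms(3,5)]
    compose_orbit_map[OF assms(1,4,3)] by (simp add: generated_def)

lemma generated_base: "x \<in> points (omap F R) \<Longrightarrow> generated R r\<^sub>0 x = x"
  using amap_id[OF R] by (simp add: generated_def orbit_map_id)

lemma translate_closed: "g \<in> carrier G \<Longrightarrow> ract R r\<^sub>0 g \<in> points R"
  by (rule ract_closed[OF R r0])

lemma generated_balanced:
  assumes "S \<in> Ob (Fin G)" "s \<in> points S" "g \<in> carrier G" "x \<in> points (omap F R)"
  shows "generated S (ract S s g) x = generated S s (generated R (ract R r\<^sub>0 g) x)"
  using amap_generated[OF R assms(1) orbit_map_hom[OF assms(1,2)] translate_closed[OF assms(3)] assms(4)]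
    orbit_map_point[OF assms(3)] by (simp add: generated_def)

lemma value_biset_group_action:
  "group_action G (points value_biset) (lact value_biset)"
proof -
  let ?X = "points (omap F R)" and ?l = "\<lambda>g. generated R (ract R r\<^sub>0 g)"
  have mult: "?l (g \<otimes>\<^bsub>G\<^esub> h) x = ?l g (?l h x)"
    if "g \<in> carrier G" "h \<in> carrier G" "x \<in> ?X" for g h x
    using that generated_balanced[OF R translate_closed[OF that(1)] that(2,3)]
    by (simp add: ract_mult[OF R r0])
  have one: "?l \<one>\<^bsub>G\<^esub> x = x" if "x \<in> ?X" for x
    using that by (simp add: ract_one[OF R r0] generated_base)
  have closed: "?l g x \<in> ?X" if "g \<in> carrier G" "x \<in> ?X" for g x
    using that by (intro generated_closed R translate_closed)
  have ext: "?l g \<in> extensional ?X" if "g \<in> carrier G" for g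
    using generated_hom[OF R translate_closed[OF that]] by (rule equivariant_maps_extensional)
  have Bij: "?l g \<in> Bij ?X" if g: "g \<in> carrier G" for g
  proof -
    have "bij_betw (?l g) ?X ?X"
    proof (rule bij_betw_byWitness[where f' = "?l (inv\<^bsub>G\<^esub> g)"])
      show "\<forall>x\<in>?X. ?l (inv\<^bsub>G\<^esub> g) (?l g x) = x" "\<forall>x\<in>?X. ?l g (?l (inv\<^bsub>G\<^esub> g) x) = x"
        using g by (simp_all add: mult[symmetric] one)
    qed (use g closed in auto)
    then show ?thesis using ext[OF g] by (simp add: Bij_def)
  qed
  have "?l \<in> hom G (BijGroup ?X)"
  proof (rule homI)
    show "?l g \<in> carrier (BijGroup ?X)" if "g \<in> carrier G" for g
      using Bij[OF that] by (simp add: BijGroup_def)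
    fix g h assume g: "g \<in> carrier G" and h: "h \<in> carrier G"
    have "?l (g \<otimes>\<^bsub>G\<^esub> h) = compose ?X (?l g) (?l h)"
      by (rule extensionalityI[OF ext compose_extensional]) (use g h mult in \<open>simp_all add: compose_eq\<close>)
    then show "?l (g \<otimes>\<^bsub>G\<^esub> h) = ?l g \<otimes>\<^bsub>BijGroup ?X\<^esub> ?l h"
      using Bij g h by (simp add: BijGroup_def)
  qed
  then show ?thesis
    using group_BijGroup[of ?X] G.is_group
    by (simp add: group_action_def group_hom_def group_hom_axioms_def value_biset_def)
qed

text \<open>The free right set on \<open>C\<close> is the coproduct of copies of the free orbit indexed by \<open>C\<close>, so a
  functor that preserves finite coproducts takes a basis \<open>j\<close> to a decomposition of its value into
  copies of \<open>F R\<close>.\<close>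

lemma free_gset_exists:
  assumes cop: "preserves_finite_coproducts (Fin G) (Fin H) F" and C: "finite C"
  obtains K j where "K \<in> Ob (Fin G)" "\<And>c. c \<in> C \<Longrightarrow> j c \<in> points K"
    "bij_betw (\<lambda>(c, g). ract K (j c) g) (C \<times> carrier G) (points K)"
    "bij_betw (\<lambda>(c, x). generated K (j c) x) (C \<times> points (omap F R)) (points (omap F K))"
proof -
  obtain d and n :: nat where d: "bij_betw d C {..<n}"
    using ex_bij_betw_finite_nat[OF C] by (metis atLeast0LessThan)
  let ?I = "{..<n}"
  obtain K :: "('u, 'g) gset" and i where K: "K \<in> Ob (Fin G)"
    and i: "\<And>m. m \<in> ?I \<Longrightarrow> i m \<in> equivariant_maps G R K"
    and bij: "bij_betw (\<lambda>(m, a). i m a) (?I \<times> points R) (points K)"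
    using disjoint_union_exists[OF G.is_group finite_lessThan, of n "\<lambda>_. R"] R by metis
  have "is_coproduct (Fin G) ?I (\<lambda>_. R) K i"
    by (rule is_coproduct_FinI) (use R K i bij in auto)
  then have "is_coproduct (Fin H) ?I (\<lambda>_. omap F R) (omap F K) (\<lambda>m. amap F R K (i m))"
    using cop unfolding preserves_finite_coproducts_def by blast
  then have Fbij: "bij_betw (\<lambda>(m, x). amap F R K (i m) x) (?I \<times> points (omap F R)) (points (omap F K))"
    by (simp add: is_coproduct_Fin_iff[OF H.is_group])
  define j where "j c = i (d c) r\<^sub>0" for c
  have dc: "d c \<in> ?I" if "c \<in> C" for c using d that by (auto simp: bij_betw_def)
  have j: "j c \<in> points K" if "c \<in> C" for c
    using equivariant_maps_closed[OF i[OF dc[OF that]] r0] by (simp add: j_def)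
  have "bij_betw (\<lambda>(c, g). ract K (j c) g) (C \<times> carrier G) (points K)"
    using bij_betw_trans[OF bij_betw_map_prod[OF d free] bij]
    by (rule bij_betw_cong[THEN iffD1, rotated])
      (auto simp: j_def equivariant_maps_ract[OF i[OF dc] r0])
  moreover have gen: "generated K (j c) x = amap F R K (i (d c)) x" if "c \<in> C" for c x
    using orbit_map_unique[OF i[OF dc[OF that]]] by (simp add: generated_def j_def)
  have "bij_betw (\<lambda>(c, x). generated K (j c) x) (C \<times> points (omap F R)) (points (omap F K))"
    using bij_betw_trans[OF bij_betw_map_prod[OF d bij_betw_id] Fbij]
    by (rule bij_betw_cong[THEN iffD1, rotated]) (auto simp: gen)
  ultimately show thesis using j by (intro that[OF K])
qed

lemma free_gset_map:
  assumes K: "K \<in> Ob (Fin G)" and j: "\<And>c. c \<in> C \<Longrightarrow> j c \<in> points K"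
    and basis: "bij_betw (\<lambda>(c, g). ract K (j c) g) (C \<times> carrier G) (points K)"
    and S: "S \<in> Ob (Fin G)" and s: "\<And>c. c \<in> C \<Longrightarrow> s c \<in> points S"
  obtains u where "u \<in> equivariant_maps G K S" "\<And>c. c \<in> C \<Longrightarrow> u (j c) = s c"
    "\<And>c g. c \<in> C \<Longrightarrow> g \<in> carrier G \<Longrightarrow> u (ract K (j c) g) = ract S (s c) g"
proof -
  define d where "d = the_inv_into (C \<times> carrier G) (\<lambda>(c, g). ract K (j c) g)"
  have d: "d (ract K (j c) g) = (c, g)" if "c \<in> C" "g \<in> carrier G" for c g
    using the_inv_into_f_f[OF bij_betw_imp_inj_on[OF basis], of "(c, g)"] that by (simp add: d_def)
  define u where "u = (\<lambda>k\<in>points K. (\<lambda>(c, g). ract S (s c) g) (d k))"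
  have u: "u (ract K (j c) g) = ract S (s c) g" if "c \<in> C" "g \<in> carrier G" for c g
    using that d ract_closed[OF K j] by (simp add: u_def)
  have "u \<in> equivariant_maps G K S"
  proof (rule equivariant_mapsI)
    fix k assume "k \<in> points K"
    then obtain c g where k: "c \<in> C" "g \<in> carrier G" "k = ract K (j c) g"
      unfolding bij_betw_imp_surj_on[OF basis, symmetric] by auto
    then show "u k \<in> points S" using u ract_closed[OF S s] by simp
    fix h assume "h \<in> carrier G"
    then show "u (ract K k h) = ract S (u k) h"
      using k u by (simp add: ract_mult[OF K j, symmetric] ract_mult[OF S s, symmetric])
  qed (simp add: u_def)
  moreover have "u (j c) = s c" if "c \<in> C" for c
    using u[OF that G.one_closed] that by (simp add: ract_one[OF K j] ract_one[OF S s])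
  ultimately show thesis using u by (rule that)
qed

text \<open>The free right set on the points of \<open>S\<close> maps onto \<open>S\<close>; \<open>F\<close> preserves this epimorphism, and the
  points of its source are known from the basis.\<close>

lemma generated_surj:
  assumes cop: "preserves_finite_coproducts (Fin G) (Fin H) F" and epi: "preserves_epis (Fin G) (Fin H) F"
    and S: "S \<in> Ob (Fin G)" and y: "y \<in> points (omap F S)"
  obtains s x where "s \<in> points S" "x \<in> points (omap F R)" "y = generated S s x"
proof -
  have "finite (points S)" using S by (simp add: Ob_Fin)
  then obtain K j where K: "K \<in> Ob (Fin G)" and j: "\<And>s. s \<in> points S \<Longrightarrow> j s \<in> points K"
    and basis: "bij_betw (\<lambda>(s, g). ract K (j s) g) (points S \<times> carrier G) (points K)"
    and Fbasis: "bij_betw (\<lambda>(s, x). generated K (j s) x) (points S \<times> points (omap F R)) (points (omap F K))"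
    using free_gset_exists[OF cop] by metis
  obtain u where u: "u \<in> equivariant_maps G K S" and uj: "\<And>s. s \<in> points S \<Longrightarrow> u (j s) = s"
    using free_gset_map[OF K j basis S, where s = "\<lambda>s. s"] by metis
  have "u ` points K = points S"
    using equivariant_maps_closed[OF u] uj j by (metis image_subsetI image_eqI subsetI subset_antisym)
  then have "is_epi (Fin G) K S u"
    using K S u by (simp add: is_epi_Fin_iff[OF G.is_group])
  then have "is_epi (Fin H) (omap F K) (omap F S) (amap F K S u)"
    using epi by (simp add: preserves_epis_def)
  then obtain w where w: "w \<in> points (omap F K)" "y = amap F K S u w"
    using y unfolding is_epi_Fin_iff[OF H.is_group] by blast
  obtain s x where s: "s \<in> points S" "x \<in> points (omap F R)" "w = generated K (j s) x"
    using w(1) unfolding bij_betw_imp_surj_on[OF Fbasis, symmetric] by auto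
  then have "y = generated S s x"
    using w amap_generated[OF K S u j] uj by simp
  then show thesis using that s by blast
qed

text \<open>The pullback of the maps out of the free orbit given by \<open>s\<close> and \<open>t\<close> is the free right set on
  the group elements that take \<open>t\<close> to \<open>s\<close>: the pair \<open>(r\<^sub>0 g, r\<^sub>0 h)\<close> lies in it iff \<open>s g = t h\<close>, that is,
  iff \<open>c = h g\<^sup>-\<^sup>1\<close> satisfies \<open>s = t c\<close>. Since \<open>F\<close> preserves the pullback and the coproduct, the pairs that
  are identified in \<open>F S\<close> are described by the same group elements, each of them uniquely.\<close>

lemma generated_pairs:
  assumes cop: "preserves_finite_coproducts (Fin G) (Fin H) F"
    and pb: "preserves_pullbacks (Fin G) (Fin H) F"
    and S: "S \<in> Ob (Fin G)" and s: "s \<in> points S" and t: "t \<in> points S"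
  shows "bij_betw (\<lambda>(c, x). (x, generated R (ract R r\<^sub>0 c) x))
    ({c \<in> carrier G. s = ract S t c} \<times> points (omap F R))
    {(x, y) \<in> points (omap F R) \<times> points (omap F R). generated S s x = generated S t y}"
proof -
  define C where "C = {c \<in> carrier G. s = ract S t c}"
  have CG: "c \<in> carrier G" if "c \<in> C" for c using that by (simp add: C_def)
  have "finite C" using finite_G by (simp add: C_def)
  then obtain K j where K: "K \<in> Ob (Fin G)" and j: "\<And>c. c \<in> C \<Longrightarrow> j c \<in> points K"
    and basis: "bij_betw (\<lambda>(c, g). ract K (j c) g) (C \<times> carrier G) (points K)"
    and Fbasis: "bij_betw (\<lambda>(c, x). generated K (j c) x) (C \<times> points (omap F R)) (points (omap F K))"
    using free_gset_exists[OF cop] by metis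
  \<comment> \<open>The projections of the pullback: \<open>j c\<close> is to be the pair of \<open>r\<^sub>0\<close> and \<open>r\<^sub>0 c\<close>.\<close>
  obtain p where p: "p \<in> equivariant_maps G K R" and pj: "\<And>c. c \<in> C \<Longrightarrow> p (j c) = r\<^sub>0"
    and pg: "\<And>c g. c \<in> C \<Longrightarrow> g \<in> carrier G \<Longrightarrow> p (ract K (j c) g) = ract R r\<^sub>0 g"
    using free_gset_map[OF K j basis R, where s = "\<lambda>c. r\<^sub>0"] r0 by metis
  obtain q where q: "q \<in> equivariant_maps G K R" and qj: "\<And>c. c \<in> C \<Longrightarrow> q (j c) = ract R r\<^sub>0 c"
    and qg: "\<And>c g. c \<in> C \<Longrightarrow> g \<in> carrier G \<Longrightarrow> q (ract K (j c) g) = ract R (ract R r\<^sub>0 c) g"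
    using free_gset_map[OF K j basis R, where s = "ract R r\<^sub>0"] CG translate_closed by metis
  have qg': "q (ract K (j c) g) = ract R r\<^sub>0 (c \<otimes>\<^bsub>G\<^esub> g)" if "c \<in> C" "g \<in> carrier G" for c g
    using that qg CG by (simp add: ract_mult[OF R r0])
  let ?Q = "{(a, b) \<in> points R \<times> points R. orbit_map S s a = orbit_map S t b}"
  have "bij_betw (\<lambda>z. (p z, q z)) (points K) ?Q"
    unfolding bij_betw_def
  proof
    have KE: thesis if "k \<in> points K" "\<And>c g. c \<in> C \<Longrightarrow> g \<in> carrier G \<Longrightarrow> k = ract K (j c) g \<Longrightarrow> thesis"
      for k thesis
      using that unfolding bij_betw_imp_surj_on[OF basis, symmetric] by auto
    show "inj_on (\<lambda>z. (p z, q z)) (points K)"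
    proof (rule inj_onI, elim Pair_inject)
      fix k k' assume k: "k \<in> points K" "k' \<in> points K" "p k = p k'" "q k = q k'"
      obtain c g where c: "c \<in> C" "g \<in> carrier G" "k = ract K (j c) g" using KE[OF k(1)] .
      obtain c' g' where c': "c' \<in> C" "g' \<in> carrier G" "k' = ract K (j c') g'" using KE[OF k(2)] .
      have "g = g'" using k c c' pg point_inj by metis
      moreover have "c \<otimes>\<^bsub>G\<^esub> g = c' \<otimes>\<^bsub>G\<^esub> g'" using k c c' qg' point_inj CG G.m_closed by metis
      ultimately show "k = k'" using c c' CG by simp
    qed
    show "(\<lambda>z. (p z, q z)) ` points K = ?Q"
    proof
      show "(\<lambda>z. (p z, q z)) ` points K \<subseteq> ?Q"
      proof (rule image_subsetI)
        fix k assume k: "k \<in> points K"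
        obtain c g where c: "c \<in> C" "g \<in> carrier G" "k = ract K (j c) g" using KE[OF k] .
        have "ract S s g = ract S t (c \<otimes>\<^bsub>G\<^esub> g)"
          using c by (simp add: ract_mult[OF S t] C_def)
        then show "(p k, q k) \<in> ?Q"
          using c CG pg qg' translate_closed by (simp add: orbit_map_point)
      qed
      show "?Q \<subseteq> (\<lambda>z. (p z, q z)) ` points K"
      proof clarify
        fix a b assume ab: "a \<in> points R" "b \<in> points R" "orbit_map S s a = orbit_map S t b"
        obtain g where g: "g \<in> carrier G" "a = ract R r\<^sub>0 g" using ab(1) by (rule pointE)
        obtain h where h: "h \<in> carrier G" "b = ract R r\<^sub>0 h" using ab(2) by (rule pointE)
        define c where "c = h \<otimes>\<^bsub>G\<^esub> inv\<^bsub>G\<^esub> g"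
        have "s = ract S (ract S s g) (inv\<^bsub>G\<^esub> g)"
          using g by (simp add: ract_mult[OF S s, symmetric] ract_one[OF S s])
        also have "ract S s g = ract S t h"
          using ab g h by (simp add: orbit_map_point)
        finally have c: "c \<in> C"
          using g h by (simp add: C_def c_def ract_mult[OF S t])
        have "c \<otimes>\<^bsub>G\<^esub> g = h" using g h by (simp add: c_def G.m_assoc)
        then have "(a, b) = (p (ract K (j c) g), q (ract K (j c) g))"
          using c g h pg qg' by simp
        then show "(a, b) \<in> (\<lambda>z. (p z, q z)) ` points K"
          using ract_closed[OF K j[OF c] g(1)] by blast
      qed
    qed
  qed
  then have "is_pullback (Fin G) R R S K (orbit_map S s) (orbit_map S t) p q"
    unfolding is_pullback_Fin_iff[OF G.is_group finite_G]
    using R S K p q orbit_map_hom[OF S s] orbit_map_hom[OF S t] by blast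
  then have "is_pullback (Fin H) (omap F R) (omap F R) (omap F S) (omap F K)
      (generated S s) (generated S t) (amap F K R p) (amap F K R q)"
    using pb unfolding preserves_pullbacks_def generated_def by blast
  then have Fbij: "bij_betw (\<lambda>w. (amap F K R p w, amap F K R q w)) (points (omap F K))
      {(x, y) \<in> points (omap F R) \<times> points (omap F R). generated S s x = generated S t y}"
    unfolding is_pullback_Fin_iff[OF H.is_group finite_H] by blast
  show ?thesis
    unfolding C_def[symmetric] using bij_betw_trans[OF Fbasis Fbij]
    by (rule bij_betw_cong[THEN iffD1, rotated])
      (auto simp: amap_generated[OF K R p j] amap_generated[OF K R q j] pj qj generated_base)
qed

text \<open>For a one-point set every group element takes the point to itself, so the domain of the
  bijection above is all of \<open>G \<times> F R\<close>. If \<open>g x = x\<close>, then \<open>(g, x)\<close> and \<open>(1, x)\<close> have the same image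
  \<open>(x, x)\<close>.\<close>

lemma value_biset_free:
  assumes cop: "preserves_finite_coproducts (Fin G) (Fin H) F"
    and pb: "preserves_pullbacks (Fin G) (Fin H) F"
    and x: "x \<in> points (omap F R)" and g: "g \<in> carrier G" and stab: "generated R (ract R r\<^sub>0 g) x = x"
  shows "g = \<one>\<^bsub>G\<^esub>"
proof -
  define T :: "(unit, 'g) gset" where
    "T = \<lparr>points = UNIV, ract = (\<lambda>s g. if g \<in> carrier G then s else undefined)\<rparr>"
  have "right_gset G T" "finite (points T)" by (auto simp: T_def right_gset_def)
  then obtain S :: "('u, 'g) gset" and e where S: "S \<in> Ob (Fin G)"
    and e: "\<And>t g. t \<in> points T \<Longrightarrow> g \<in> carrier G \<Longrightarrow> e (ract T t g) = ract S (e t) g"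
    and bij: "bij_betw e (points T) (points S)"
    using G.is_group by (rule gset_transport) (rule that)
  have s: "e () \<in> points S" using bij by (auto simp: T_def bij_betw_def)
  have C: "e () = ract S (e ()) c" if "c \<in> carrier G" for c
    using e[of "()" c] that by (simp add: T_def)
  have "(g, x) = (\<one>\<^bsub>G\<^esub>, x)"
    using bij_betw_imp_inj_on[OF generated_pairs[OF cop pb S s s]]
    by (rule inj_onD) (use C g x stab in \<open>simp_all add: ract_one[OF R r0] generated_base\<close>)
  then show ?thesis by simp
qed

text \<open>The identifications made by the pairing are those of the balanced relation: in one direction by
  the description of the pairs above, in the other because the pairing is balanced.\<close>

lemma value_presentation:
  assumes cop: "preserves_finite_coproducts (Fin G) (Fin H) F"
    and pb: "preserves_pullbacks (Fin G) (Fin H) F" and epi: "preserves_epis (Fin G) (Fin H) F"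
  shows "tensor_presentation G H F value_biset generated"
proof -
  have FR: "right_gset H (omap F R)" "finite (points (omap F R))"
    using omap_Ob[OF R] by (simp_all add: Ob_Fin)
  have pts: "points value_biset = points (omap F R)"
    and lact: "lact value_biset g = generated R (ract R r\<^sub>0 g)"
    and ra: "ract value_biset = ract (omap F R)" for g
    by (simp_all add: value_biset_def)
  show ?thesis
  proof
    show "value_biset \<in> FinBiset G H"
      unfolding FinBiset_def
    proof (intro CollectI conjI ballI impI)
      show "right_gset H value_biset" using FR by (simp add: right_gset_def value_biset_def)
      show "group_action G (points value_biset) (lact value_biset)" by (rule value_biset_group_action)
      fix x g assume x: "x \<in> points value_biset" and g: "g \<in> carrier G"
      show "lact value_biset g (ract value_biset x h) = ract value_biset (lact value_biset g x) h"
        if "h \<in> carrier H" for h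
        using equivariant_maps_ract[OF generated_hom[OF R translate_closed[OF g]]] x that
        by (simp add: pts lact ra)
      show "g = \<one>\<^bsub>G\<^esub>" if "lact value_biset g x = x"
        using value_biset_free[OF cop pb _ g] x that by (simp add: pts lact)
    qed (use FR in \<open>simp add: pts\<close>)
  next
    fix S :: "('u, 'g) gset" assume S: "S \<in> Ob (Fin G)"
    show "\<exists>s x. s \<in> points S \<and> x \<in> points value_biset \<and> y = generated S s x"
      if "y \<in> points (omap F S)" for y
      using generated_surj[OF cop epi S that] unfolding pts by metis
    fix s x assume s: "s \<in> points S" and x: "x \<in> points value_biset"
    then have x': "x \<in> points (omap F R)" by (simp add: pts)
    show "generated S s x \<in> points (omap F S)" by (rule generated_closed[OF S s x'])
    show "generated S s (ract value_biset x h) = ract (omap F S) (generated S s x) h"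
      if "h \<in> carrier H" for h
      using equivariant_maps_ract[OF generated_hom[OF S s] x' that] by (simp add: ra)
    show "amap F S T f (generated S s x) = generated T (f s) x"
      if "T \<in> Ob (Fin G)" "f \<in> equivariant_maps G S T" for T :: "('u, 'g) gset" and f
      by (rule amap_generated[OF S that s x'])
    show "generated S s x = generated S t y \<longleftrightarrow>
        (\<exists>g\<in>carrier G. s = ract S t g \<and> y = lact value_biset g x)"
      if t: "t \<in> points S" and y: "y \<in> points value_biset" for t y
    proof
      assume "generated S s x = generated S t y"
      then have "(x, y) \<in> {(x, y) \<in> points (omap F R) \<times> points (omap F R). generated S s x = generated S t y}"
        using x y by (simp add: pts)
      then show "\<exists>g\<in>carrier G. s = ract S t g \<and> y = lact value_biset g x"
        unfolding bij_betw_imp_surj_on[OF generated_pairs[OF cop pb S s t], symmetric] lact by auto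
    next
      assume "\<exists>g\<in>carrier G. s = ract S t g \<and> y = lact value_biset g x"
      then show "generated S s x = generated S t y"
        using generated_balanced[OF S t _ x'] by (auto simp: lact)
    qed
  qed
qed

end


section \<open>The characterisation\<close>

theorem theorem4p0p0p2:
  fixes G :: "('g, 'a) monoid_scheme" and H :: "('h, 'b) monoid_scheme"
    and F :: "(('u::infinite, 'g) gset, 'u \<Rightarrow> 'u, ('v::infinite, 'h) gset, 'v \<Rightarrow> 'v) cfunctor"
  assumes "group G" and "finite (carrier G)"
    and "group H" and "finite (carrier H)"
    and "is_functor (Fin G) (Fin H) F"
  shows "preserves_pullbacks (Fin G) (Fin H) F \<and>
         preserves_epis (Fin G) (Fin H) F \<and>
         preserves_finite_coproducts (Fin G) (Fin H) F \<longleftrightarrow>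
         (\<exists>X :: ('v, 'h, 'g) biset. X \<in> FinBiset G H \<and>
            naturally_isomorphic (Fin G) H F (tensor_functor G H X))"
    (is "?pres \<longleftrightarrow> ?tensor")
proof -
  interpret F: fin_functor G H F
    using assms by (simp add: fin_functor_def fin_functor_axioms_def)
  show ?thesis
  proof
    assume pres: ?pres
    obtain R :: "('u, 'g) gset" and r where "free_orbit G R r"
      using free_orbit_exists[OF assms(1,2)] by blast
    then interpret evaluated_functor G H F R r
      by (intro evaluated_functor.intro F.fin_functor_axioms)
    interpret tensor_presentation G H F value_biset generated
      using value_presentation pres by blast
    show ?tensor using X naturally_isomorphic by blast
  next
    assume ?tensor
    then obtain X :: "('v, 'h, 'g) biset" where
      X: "X \<in> FinBiset G H" "naturally_isomorphic (Fin G) H F (tensor_functor G H X)" by blast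
    obtain \<kappa> where "tensor_presentation G H F X \<kappa>"
      using F.tensor_presentation_of_iso[OF X] by blast
    then interpret tensor_presentation G H F X \<kappa> .
    show ?pres using pullbacks epis finite_coproducts by blast
  qed
qed

end
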